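(* Let $(G_n,R^m_n)$ be a sequence in $\mathbf{S}$ with induced poset $\mathbb{P}$. Then: (1) $(G_n,R^m_n)$ is surjective if and only if $\mathbb{P}$ is atomless. (2) $(G_n,R^m_n)$ is co-injective if and only if $\mathbb{P}$ is predetermined and atomless. If moreover $(G_n,R^m_n)$ is a sequence in $\mathbf{B}$, then: (3) $(G_n,R^m_n)$ has an anti-injective subsequence if and only if $\mathsf{S}\mathbb{P}$ is perfect (has no isolated points). (4) The following are equivalent: $(G_n,R^m_n)$ is anti-injective; $\mathbb{P}$ is branching; $\mathbb{P}$ is cap-determined. If, in addition to being in $\mathbf{B}$, $(G_n,R^m_n)$ is edge-faithful, then: (5) The following are equivalent: $(G_n,R^m_n)$ has a star-refining subsequence; $\mathbb{P}$ is regular; $\mathsf{S}\mathbb{P}$ is Hausdorff; $\mathsf{S}\mathbb{P}$ is metrizable.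
   Context: Graphs and relations. A graph is a finite non-empty set $G$ with a reflexive symmetric relation $\sqcap$ (the edge relation). A relation $R\subseteq H\times G$ between graphs is viewed as a relation from $G$ to $H$; write $R(g)=\{h:(h,g)\in R\}$ and $R^{-1}(h)=\{g:(h,g)\in R\}$; $(c,a)\in Q\circ R$ iff $(c,b)\in Q$ and $(b,a)\in R$ for some $b$. $R$ is: edge-preserving if $(h,g),(h',g')\in R$ and $g\sqcap g'$ imply $h\sqcap h'$; surjective if $R^{-1}(h)\ne\emptyset$ for all $h$; co-surjective if $R(g)\neq\emptyset$ for all $g$; co-injective if for all $h\in H$ there is $g$ with $R(g)=\{h\}$; co-bijective if co-injective and co-surjective; anti-injective if $|R^{-1}(h)|\ge2$ for all $h$; star-refining if for all $g\in G$ there is $h\in H$ with $\{g':g'\sqcap g\}\subseteq R^{-1}(h)$. $\mathbf{S}$ (resp. $\mathbf{B}$) is the category of graphs with co-surjective (resp. co-bijective) edge-preserving relations. Sequences. A sequence in $\mathbf{C}$ is a family $(G_n,R^m_n)_{m\le n\in\omega}$ with $R^m_n$ a morphism of $\mathbf{C}$ from $G_n$ to $G_m$, $R^n_n$ the identity and $R^l_m\circ R^m_n=R^l_n$ for $l\le m\le n$. It has a property of morphisms if $R^m_n$ has it for all $m<n$. A subsequence is $(G_{\phi(n)},R^{\phi(m)}_{\phi(n)})$ for a strictly increasing $\phi:\omega\to\omega$. The induced poset is the disjoint union $\mathbb{P}=\bigsqcup_nG_n$, where for $p\in G_n$, $q\in G_m$, $p\le q$ iff $m\le n$ and $(q,p)\in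 R^m_n$. The sequence is edge-faithful if for all $n$ and $g,h\in G_n$: $g\sqcap h$ iff $g,h$ have a common lower bound in $\mathbb{P}$. Posets. For a poset $\mathbb{P}$: a band is a finite $B\subseteq\mathbb{P}$ such that every element of $\mathbb{P}$ is comparable to an element of $B$; for $A,B\subseteq\mathbb{P}$, $A\le B$ means each $a\in A$ is $\le$ some $b\in B$; a cap is a set $C\subseteq\mathbb P$ with $B\le C$ for some band $B$; an atom is a minimal element, and $\mathbb{P}$ is atomless if it has no atoms; $\mathbb{P}$ is predetermined if for every non-atom $p$ there is $q<p$ with $\{r:q<r\}=\{r:p\le r\}$; branching if whenever $p<q$ there is $r<q$ incomparable with $p$; cap-determined if, for all $p,q\in\mathbb{P}$, [for all $F\subseteq\mathbb{P}$, $\{p\}\cup F$ a cap implies $\{q\}\cup F$ a cap] implies $p\le q$. For $p,q\in\mathbb{P}$, $p\vartriangleleft q$ means there is a cap $C$ such that every $c\in C$ having a common lower bound with $p$ satisfies $c\le q$; $\mathbb{P}$ is regular if for every cap $C$ there is a cap $D$ such that every $d\in D$ satisfies $d\vartriangleleft c$ for some $c\in C$. A selector is a subset of $\mathbb{P}$ meeting every cap. The spectrum $\mathsf{S}\mathbb{P}$ is the set of minimal selectors (with respect to inclusion) with the topology generated by the sets $p^\in=\{S\in\mathsf{S}\mathbb{P}:p\in S\}$, $p\in\mathbb{P}$. *)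

theory Defs
  imports "HOL-Analysis.Analysis"
begin

section \<open>Graphs and relations\<close>

record 'a graph =
  vertices :: "'a set"
  edges :: "'a rel"

definition wf_graph :: "'a graph \<Rightarrow> bool" where
  "wf_graph G \<longleftrightarrow> finite (vertices G) \<and> vertices G \<noteq> {} \<and>
     edges G \<subseteq> vertices G \<times> vertices G \<and> refl_on (vertices G) (edges G) \<and> sym (edges G)"

text \<open>
  Every property of a relation from \<open>G\<close> to \<open>H\<close> takes the arguments \<open>G H R\<close>, with
  \<open>R \<subseteq> vertices H \<times> vertices G\<close>: the codomain is the \<^emph>\<open>first\<close> component of the pairs,
  so that relational composition is the library's \<open>O\<close>.  With this orientation
  \<open>rel_image R g\<close> is what is usually written \<open>R(g)\<close>, and \<open>rel_preimage R h\<close> is \<open>R\<inverse>(h)\<close>.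
\<close>

definition rel_image :: "'a rel \<Rightarrow> 'a \<Rightarrow> 'a set" where
  "rel_image R g = {h. (h, g) \<in> R}"

definition rel_preimage :: "'a rel \<Rightarrow> 'a \<Rightarrow> 'a set" where
  "rel_preimage R h = {g. (h, g) \<in> R}"

definition edge_preserving :: "'a graph \<Rightarrow> 'a graph \<Rightarrow> 'a rel \<Rightarrow> bool" where
  "edge_preserving G H R \<longleftrightarrow>
     (\<forall>h g h' g'. (h, g) \<in> R \<and> (h', g') \<in> R \<and> (g, g') \<in> edges G \<longrightarrow> (h, h') \<in> edges H)"

definition surjective :: "'a graph \<Rightarrow> 'a graph \<Rightarrow> 'a rel \<Rightarrow> bool" where
  "surjective G H R \<longleftrightarrow> (\<forall>h\<in>vertices H. rel_preimage R h \<noteq> {})"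

definition co_surjective :: "'a graph \<Rightarrow> 'a graph \<Rightarrow> 'a rel \<Rightarrow> bool" where
  "co_surjective G H R \<longleftrightarrow> (\<forall>g\<in>vertices G. rel_image R g \<noteq> {})"

definition co_injective :: "'a graph \<Rightarrow> 'a graph \<Rightarrow> 'a rel \<Rightarrow> bool" where
  "co_injective G H R \<longleftrightarrow> (\<forall>h\<in>vertices H. \<exists>g\<in>vertices G. rel_image R g = {h})"

definition co_bijective :: "'a graph \<Rightarrow> 'a graph \<Rightarrow> 'a rel \<Rightarrow> bool" where
  "co_bijective G H R \<longleftrightarrow> co_injective G H R \<and> co_surjective G H R"

definition anti_injective :: "'a graph \<Rightarrow> 'a graph \<Rightarrow> 'a rel \<Rightarrow> bool" where
  "anti_injective G H R \<longleftrightarrow> (\<forall>h\<in>vertices H. card (rel_preimage R h) \<ge> 2)"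

definition star_refining :: "'a graph \<Rightarrow> 'a graph \<Rightarrow> 'a rel \<Rightarrow> bool" where
  "star_refining G H R \<longleftrightarrow>
     (\<forall>g\<in>vertices G. \<exists>h\<in>vertices H. {g'. (g', g) \<in> edges G} \<subseteq> rel_preimage R h)"

text \<open>Morphisms of the categories \<open>S\<close> and \<open>B\<close>, from \<open>G\<close> to \<open>H\<close>.\<close>

definition S_morphism :: "'a graph \<Rightarrow> 'a graph \<Rightarrow> 'a rel \<Rightarrow> bool" where
  "S_morphism G H R \<longleftrightarrow>
     R \<subseteq> vertices H \<times> vertices G \<and> co_surjective G H R \<and> edge_preserving G H R"

definition B_morphism :: "'a graph \<Rightarrow> 'a graph \<Rightarrow> 'a rel \<Rightarrow> bool" where
  "B_morphism G H R \<longleftrightarrow>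
     R \<subseteq> vertices H \<times> vertices G \<and> co_bijective G H R \<and> edge_preserving G H R"


section \<open>Sequences of graphs\<close>

text \<open>\<open>R m n\<close> is the morphism from \<open>G n\<close> to \<open>G m\<close>; only its values for \<open>m \<le> n\<close> matter.\<close>

definition sequence_in ::
    "('a graph \<Rightarrow> 'a graph \<Rightarrow> 'a rel \<Rightarrow> bool) \<Rightarrow> (nat \<Rightarrow> 'a graph) \<Rightarrow> (nat \<Rightarrow> nat \<Rightarrow> 'a rel) \<Rightarrow> bool" where
  "sequence_in mor G R \<longleftrightarrow>
     (\<forall>n. wf_graph (G n)) \<and>
     (\<forall>m n. m \<le> n \<longrightarrow> mor (G n) (G m) (R m n)) \<and>
     (\<forall>n. R n n = Id_on (vertices (G n))) \<and>
     (\<forall>l m n. l \<le> m \<and> m \<le> n \<longrightarrow> R l m O R m n = R l n)"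

definition seq_has ::
    "('a graph \<Rightarrow> 'a graph \<Rightarrow> 'a rel \<Rightarrow> bool) \<Rightarrow> (nat \<Rightarrow> 'a graph) \<Rightarrow> (nat \<Rightarrow> nat \<Rightarrow> 'a rel) \<Rightarrow> bool" where
  "seq_has Q G R \<longleftrightarrow> (\<forall>m n. m < n \<longrightarrow> Q (G n) (G m) (R m n))"

definition has_subsequence ::
    "('a graph \<Rightarrow> 'a graph \<Rightarrow> 'a rel \<Rightarrow> bool) \<Rightarrow> (nat \<Rightarrow> 'a graph) \<Rightarrow> (nat \<Rightarrow> nat \<Rightarrow> 'a rel) \<Rightarrow> bool" where
  "has_subsequence Q G R \<longleftrightarrow>
     (\<exists>\<phi>::nat \<Rightarrow> nat. strict_mono \<phi> \<and> seq_has Q (\<lambda>n. G (\<phi> n)) (\<lambda>m n. R (\<phi> m) (\<phi> n)))"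

definition induced_poset :: "(nat \<Rightarrow> 'a graph) \<Rightarrow> (nat \<times> 'a) set" where
  "induced_poset G = (SIGMA n:UNIV. vertices (G n))"

definition induced_order ::
    "(nat \<Rightarrow> 'a graph) \<Rightarrow> (nat \<Rightarrow> nat \<Rightarrow> 'a rel) \<Rightarrow> (nat \<times> 'a) rel" where
  "induced_order G R = {((n, p), (m, q)). p \<in> vertices (G n) \<and> q \<in> vertices (G m) \<and>
                          m \<le> n \<and> (q, p) \<in> R m n}"


section \<open>Posets\<close>

text \<open>
  A poset is given by its carrier \<open>P\<close> and an order relation \<open>r\<close> such that
  \<open>partial_order_on P r\<close>; \<open>(p, q) \<in> r\<close> means \<open>p \<le> q\<close>.
\<close>

lemma partial_order_induced:
  assumes "sequence_in S_morphism G R"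
  shows "partial_order_on (induced_poset G) (induced_order G R)"
proof -
  have id: "R n n = Id_on (vertices (G n))" for n
    using assms by (simp add: sequence_in_def)
  have comp: "l \<le> m \<Longrightarrow> m \<le> n \<Longrightarrow> R l m O R m n = R l n" for l m n
    using assms by (simp add: sequence_in_def)
  have "trans (induced_order G R)"
  proof (rule transI)
    fix x y z
    assume "(x, y) \<in> induced_order G R" and "(y, z) \<in> induced_order G R"
    moreover obtain n p m q l s where "x = (n, p)" "y = (m, q)" "z = (l, s)"
      by (metis surj_pair)
    ultimately show "(x, z) \<in> induced_order G R"
      using comp[of l m n] by (auto simp: induced_order_def)
  qed
  moreover have "antisym (induced_order G R)"
    unfolding antisym_def induced_order_def using id by (auto dest!: le_antisym)
  ultimately show ?thesis
    unfolding partial_order_on_def preorder_on_def refl_on_def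
    by (auto simp: induced_order_def induced_poset_def id Id_on_def)
qed

definition strictly_below :: "'p rel \<Rightarrow> 'p \<Rightarrow> 'p \<Rightarrow> bool" where
  "strictly_below r p q \<longleftrightarrow> (p, q) \<in> r \<and> p \<noteq> q"

definition comparable :: "'p rel \<Rightarrow> 'p \<Rightarrow> 'p \<Rightarrow> bool" where
  "comparable r p q \<longleftrightarrow> (p, q) \<in> r \<or> (q, p) \<in> r"

definition common_lower_bound :: "'p set \<Rightarrow> 'p rel \<Rightarrow> 'p \<Rightarrow> 'p \<Rightarrow> bool" where
  "common_lower_bound P r p q \<longleftrightarrow> (\<exists>s\<in>P. (s, p) \<in> r \<and> (s, q) \<in> r)"

definition band :: "'p set \<Rightarrow> 'p rel \<Rightarrow> 'p set \<Rightarrow> bool" where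
  "band P r B \<longleftrightarrow> B \<subseteq> P \<and> finite B \<and> (\<forall>p\<in>P. \<exists>b\<in>B. comparable r p b)"

definition refines :: "'p rel \<Rightarrow> 'p set \<Rightarrow> 'p set \<Rightarrow> bool" where
  "refines r A B \<longleftrightarrow> (\<forall>a\<in>A. \<exists>b\<in>B. (a, b) \<in> r)"

definition cap :: "'p set \<Rightarrow> 'p rel \<Rightarrow> 'p set \<Rightarrow> bool" where
  "cap P r C \<longleftrightarrow> C \<subseteq> P \<and> (\<exists>B. band P r B \<and> refines r B C)"

definition atom :: "'p set \<Rightarrow> 'p rel \<Rightarrow> 'p \<Rightarrow> bool" where
  "atom P r p \<longleftrightarrow> p \<in> P \<and> \<not> (\<exists>q\<in>P. strictly_below r q p)"

definition atomless :: "'p set \<Rightarrow> 'p rel \<Rightarrow> bool" where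
  "atomless P r \<longleftrightarrow> \<not> (\<exists>p. atom P r p)"

definition predetermined :: "'p set \<Rightarrow> 'p rel \<Rightarrow> bool" where
  "predetermined P r \<longleftrightarrow>
     (\<forall>p\<in>P. \<not> atom P r p \<longrightarrow>
        (\<exists>q\<in>P. strictly_below r q p \<and> {s\<in>P. strictly_below r q s} = {s\<in>P. (p, s) \<in> r}))"

definition branching :: "'p set \<Rightarrow> 'p rel \<Rightarrow> bool" where
  "branching P r \<longleftrightarrow>
     (\<forall>p\<in>P. \<forall>q\<in>P. strictly_below r p q \<longrightarrow>
        (\<exists>s\<in>P. strictly_below r s q \<and> \<not> comparable r s p))"

definition cap_determined :: "'p set \<Rightarrow> 'p rel \<Rightarrow> bool" where
  "cap_determined P r \<longleftrightarrow>
     (\<forall>p\<in>P. \<forall>q\<in>P.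
        (\<forall>F. F \<subseteq> P \<longrightarrow> cap P r ({p} \<union> F) \<longrightarrow> cap P r ({q} \<union> F)) \<longrightarrow> (p, q) \<in> r)"

text \<open>The relation \<open>p \<triangleleft> q\<close>.\<close>

definition star_below :: "'p set \<Rightarrow> 'p rel \<Rightarrow> 'p \<Rightarrow> 'p \<Rightarrow> bool" where
  "star_below P r p q \<longleftrightarrow>
     (\<exists>C. cap P r C \<and> (\<forall>c\<in>C. common_lower_bound P r c p \<longrightarrow> (c, q) \<in> r))"

definition regular_poset :: "'p set \<Rightarrow> 'p rel \<Rightarrow> bool" where
  "regular_poset P r \<longleftrightarrow>
     (\<forall>C. cap P r C \<longrightarrow> (\<exists>D. cap P r D \<and> (\<forall>d\<in>D. \<exists>c\<in>C. star_below P r d c)))"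

definition edge_faithful :: "(nat \<Rightarrow> 'a graph) \<Rightarrow> (nat \<Rightarrow> nat \<Rightarrow> 'a rel) \<Rightarrow> bool" where
  "edge_faithful G R \<longleftrightarrow>
     (\<forall>n. \<forall>g\<in>vertices (G n). \<forall>h\<in>vertices (G n).
        (g, h) \<in> edges (G n) \<longleftrightarrow>
        common_lower_bound (induced_poset G) (induced_order G R) (n, g) (n, h))"


section \<open>The spectrum\<close>

definition selector :: "'p set \<Rightarrow> 'p rel \<Rightarrow> 'p set \<Rightarrow> bool" where
  "selector P r S \<longleftrightarrow> S \<subseteq> P \<and> (\<forall>C. cap P r C \<longrightarrow> S \<inter> C \<noteq> {})"

definition spectrum :: "'p set \<Rightarrow> 'p rel \<Rightarrow> 'p set set" where
  "spectrum P r = {S. selector P r S \<and> (\<forall>T. T \<subset> S \<longrightarrow> \<not> selector P r T)}"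

text \<open>
  \<^const>\<open>topology_generated_by\<close> takes the union of the given subbasis as the underlying set;
  including the whole spectrum in the subbasis makes the spectrum the underlying set outright.
\<close>

definition spectrum_topology :: "'p set \<Rightarrow> 'p rel \<Rightarrow> 'p set topology" where
  "spectrum_topology P r =
     topology_generated_by (insert (spectrum P r) ((\<lambda>p. {S \<in> spectrum P r. p \<in> S}) ` P))"

definition has_no_isolated_points :: "'x topology \<Rightarrow> bool" where
  "has_no_isolated_points X \<longleftrightarrow> (\<forall>x\<in>topspace X. \<not> openin X {x})"

end

theory Submission
  imports Defs
begin

text \<open>
  When the sequence is surjective, a set is a cap iff some level of the poset refines it.  A
  minimal selector is then an upward closed set that meets every level and whose members at deep
  levels lie below any prescribed member.  The key fact in \<open>B\<close> is that a set of poset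
  elements whose basic open sets cover the spectrum is a cap: otherwise the elements lying below
  no member of it form an upward closed set that meets every level, and by Zorn's lemma this set
  contains a minimal selector.  Consequently the spectrum is compact, every basic open set
  is non-empty (by co-injectivity), and Hausdorff separation of points yields regularity of the
  poset.  Regularity in turn gives star-refinement because edge-faithfulness identifies edges
  with common lower bounds, and star-refinement separates points.  Finally, a compact Hausdorff
  second countable space embeds into a countable power of the reals by Urysohn functions.
\<close>

section \<open>Subsequences and metrization\<close>

text \<open>A threshold binds every later index, so choosing each index past the threshold of its
  predecessor settles all pairs of chosen indices at once.\<close>

lemma has_subsequence_if_eventually:
  assumes "\<And>m. \<exists>N. \<forall>n\<ge>N. Q (G n) (G m) (R m n)"
  shows "has_subsequence Q G R"
proof -
  obtain N where N: "\<And>m n. N m \<le> n \<Longrightarrow> Q (G n) (G m) (R m n)"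
    using assms by metis
  \<comment> \<open>The first entry of the maximum makes \<open>\<phi>\<close> strictly increasing,
    the second carries it past the threshold of the current index.\<close>
  define \<phi> where "\<phi> = rec_nat 0 (\<lambda>_ m. max (Suc m) (N m))"
  have \<phi>_Suc: "\<phi> (Suc k) = max (Suc (\<phi> k)) (N (\<phi> k))" for k
    by (simp add: \<phi>_def)
  have mono: "strict_mono \<phi>"
    by (simp add: strict_mono_Suc_iff \<phi>_Suc less_max_iff_disj)
  have "Q (G (\<phi> n)) (G (\<phi> m)) (R (\<phi> m) (\<phi> n))" if "m < n" for m n
  proof (rule N)
    have "\<phi> (Suc m) \<le> \<phi> n"
      using mono that by (simp add: strict_mono_less_eq)
    then show "N (\<phi> m) \<le> \<phi> n"
      by (simp add: \<phi>_Suc)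
  qed
  with mono show ?thesis
    unfolding has_subsequence_def seq_has_def by blast
qed

text \<open>Joint evaluation at all of \<open>F\<close> is a continuous injection of a compact space
  into a countable power of the reals. The target is metrizable, hence Hausdorff, so the injection
  is an embedding.\<close>

lemma metrizable_space_if_countably_separated:
  assumes "compact_space X" and "countable F"
    and cont: "\<And>f. f \<in> F \<Longrightarrow> continuous_map X euclideanreal f"
    and sep: "\<And>x y. \<lbrakk>x \<in> topspace X; y \<in> topspace X; x \<noteq> y\<rbrakk> \<Longrightarrow> \<exists>f\<in>F. f x \<noteq> f y"
  shows "metrizable_space X"
proof -
  let ?Y = "product_topology (\<lambda>_. euclideanreal) F"
  let ?e = "\<lambda>x. \<lambda>f\<in>F. f x"
  have Y: "metrizable_space ?Y"
    by (simp add: metrizable_space_product_topology metrizable_space_euclidean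
        countable_subset[OF _ \<open>countable F\<close>])
  have "continuous_map X ?Y ?e"
    by (auto simp: continuous_map_componentwise cont)
  moreover have "inj_on ?e (topspace X)"
    using sep by (fastforce simp: inj_on_def fun_eq_iff)
  ultimately have "embedding_map X ?Y ?e"
    using assms(1) Y metrizable_imp_Hausdorff_space continuous_imp_embedding_map by blast
  then have "X homeomorphic_space subtopology ?Y (?e ` topspace X)"
    by (rule embedding_map_imp_homeomorphic_space)
  then show ?thesis
    using Y homeomorphic_metrizable_space metrizable_space_subtopology by blast
qed

text \<open>Urysohn's metrization argument: a countable base has only countably many pairs
  \<open>(U, W)\<close> with the closure of \<open>U\<close> inside \<open>W\<close>, and one
  Urysohn function per pair suffices to separate points.\<close>

lemma compact_Hausdorff_second_countable_imp_metrizable_space: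
  assumes compact: "compact_space X" and H: "Hausdorff_space X" and "second_countable X"
  shows "metrizable_space X"
proof -
  obtain \<B> where "countable \<B>" and op: "\<And>W. W \<in> \<B> \<Longrightarrow> openin X W"
    and base: "\<And>U x. \<lbrakk>openin X U; x \<in> U\<rbrakk> \<Longrightarrow> \<exists>W\<in>\<B>. x \<in> W \<and> W \<subseteq> U"
    using assms(3) unfolding second_countable_def by metis
  have normal: "normal_space X" and regular: "regular_space X"
    using compact H by (auto simp: compact_Hausdorff_or_regular_imp_normal_space
        compact_Hausdorff_imp_regular_space)
  define I where "I = {(U, W). U \<in> \<B> \<and> W \<in> \<B> \<and> X closure_of U \<subseteq> W}"
  have "countable I"
    by (rule countable_subset[of _ "\<B> \<times> \<B>"]) (auto simp: I_def \<open>countable \<B>\<close>)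
  have "\<exists>f. continuous_map X euclideanreal f \<and> f ` (X closure_of U) \<subseteq> {0} \<and>
      f ` (topspace X - W) \<subseteq> {1}" if "(U, W) \<in> I" for U W
  proof -
    have "W \<in> \<B>" "X closure_of U \<subseteq> W"
      using that by (auto simp: I_def)
    then have "closedin X (topspace X - W)" "disjnt (X closure_of U) (topspace X - W)"
      using op by (auto simp: disjnt_def)
    then show ?thesis
      using Urysohn_lemma_alt[OF normal closedin_closure_of, of "topspace X - W" U] by metis
  qed
  then obtain f where f: "\<And>U W. (U, W) \<in> I \<Longrightarrow> continuous_map X euclideanreal (f U W) \<and>
      f U W ` (X closure_of U) \<subseteq> {0} \<and> f U W ` (topspace X - W) \<subseteq> {1::real}"
    by metis
  show ?thesis
  proof (rule metrizable_space_if_countably_separated[OF compact])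
    show "countable ((\<lambda>(U, W). f U W) ` I)"
      using \<open>countable I\<close> by blast
    show "continuous_map X euclideanreal g" if "g \<in> (\<lambda>(U, W). f U W) ` I" for g
      using that f by auto
    fix x y
    assume x: "x \<in> topspace X" and y: "y \<in> topspace X" and "x \<noteq> y"
    \<comment> \<open>The separating pair: \<open>W\<close> is a basic neighbourhood of
      \<open>x\<close> that misses \<open>y\<close>, and regularity provides a basic
      \<open>U\<close> around \<open>x\<close> with closure in \<open>W\<close>. Its function is 0
      at \<open>x\<close> and 1 at \<open>y\<close>.\<close>
    then obtain U where "openin X U" "x \<in> U" "y \<notin> U"
      using H unfolding Hausdorff_space_def disjnt_iff by metis
    then obtain W where W: "W \<in> \<B>" "x \<in> W" "y \<notin> W"
      using base by blast
    then obtain C D where CD: "openin X C" "openin X D" "x \<in> C" "topspace X - W \<subseteq> D" "disjnt C D"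
      using regular op x unfolding regular_space_def
      by (metis Diff_iff closedin_diff closedin_topspace)
    then obtain U where U: "U \<in> \<B>" "x \<in> U" "U \<subseteq> C"
      using base by meson
    have "X closure_of U \<subseteq> topspace X - D"
      using U CD openin_subset[OF \<open>openin X C\<close>]
      by (intro closure_of_minimal) (auto simp: disjnt_iff)
    then have I: "(U, W) \<in> I"
      using U W CD by (auto simp: I_def)
    have "x \<in> X closure_of U"
      using closure_of_subset[OF openin_subset[OF op[OF U(1)]]] U(2) by blast
    then have "f U W x = 0" "f U W y = 1"
      using f[OF I] W y by auto
    then show "\<exists>g\<in>(\<lambda>(U, W). f U W) ` I. g x \<noteq> g y"
      using I by force
  qed
qed

section \<open>The levels of the induced poset\<close>

locale graph_sequence =
  fixes G :: "nat \<Rightarrow> 'a graph" and R :: "nat \<Rightarrow> nat \<Rightarrow> 'a rel"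
  assumes seq: "sequence_in S_morphism G R"
begin

abbreviation P :: "(nat \<times> 'a) set" where
  "P \<equiv> induced_poset G"

abbreviation r :: "(nat \<times> 'a) rel" where
  "r \<equiv> induced_order G R"

abbreviation below :: "nat \<times> 'a \<Rightarrow> nat \<times> 'a \<Rightarrow> bool" (infix "\<preceq>" 50) where
  "x \<preceq> y \<equiv> (x, y) \<in> r"

definition level :: "nat \<Rightarrow> (nat \<times> 'a) set" where
  "level n = {x \<in> P. fst x = n}"

definition adjacent :: "nat \<times> 'a \<Rightarrow> nat \<times> 'a \<Rightarrow> bool" where
  "adjacent x y \<longleftrightarrow> fst x = fst y \<and> (snd x, snd y) \<in> edges (G (fst x))"

text \<open>The case \<open>n = fst x\<close> is included: it holds by reflexivity and saves case
  distinctions when a level is chosen merely deep enough.\<close>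

definition surjective_levels :: bool where
  "surjective_levels \<longleftrightarrow> (\<forall>x\<in>P. \<forall>n\<ge>fst x. \<exists>y\<in>level n. y \<preceq> x)"

text \<open>The last conjunct says that the image of \<open>y\<close> in the level of
  \<open>x\<close> is exactly \<open>{x}\<close>; such a \<open>y\<close> is a private lower bound
  of \<open>x\<close>.\<close>

definition coinjective_levels :: bool where
  "coinjective_levels \<longleftrightarrow>
     (\<forall>x\<in>P. \<forall>n\<ge>fst x. \<exists>y\<in>level n. y \<preceq> x \<and> (\<forall>z\<in>level (fst x). y \<preceq> z \<longrightarrow> z = x))"

lemma R_id: "R n n = Id_on (vertices (G n))"
  and R_comp: "l \<le> m \<Longrightarrow> m \<le> n \<Longrightarrow> R l m O R m n = R l n"
  and R_subset: "m \<le> n \<Longrightarrow> R m n \<subseteq> vertices (G m) \<times> vertices (G n)"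
  and wf: "wf_graph (G n)"
  using seq by (auto simp: sequence_in_def S_morphism_def)

lemma mem_P_iff: "(n, p) \<in> P \<longleftrightarrow> p \<in> vertices (G n)"
  by (simp add: induced_poset_def)

lemma mem_level_iff: "(n, p) \<in> level m \<longleftrightarrow> n = m \<and> p \<in> vertices (G m)"
  by (auto simp: level_def mem_P_iff)

lemma level_eq: "level n = Pair n ` vertices (G n)"
  by (auto simp: level_def induced_poset_def)

lemma levelD:
  assumes "x \<in> level n"
  shows "fst x = n" and "x \<in> P"
  using assms by (auto simp: level_def)

lemma levelI: "x \<in> P \<Longrightarrow> x \<in> level (fst x)"
  by (simp add: level_def)

lemma finite_level: "finite (level n)"
  using wf[of n] by (simp add: level_eq wf_graph_def)

lemma below_iff: "(n, p) \<preceq> (m, q) \<longleftrightarrow> m \<le> n \<and> (q, p) \<in> R m n"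
  using R_subset by (auto simp: induced_order_def)

lemma below_refl: "x \<in> P \<Longrightarrow> x \<preceq> x"
  by (cases x) (auto simp: below_iff R_id mem_P_iff)

lemma below_trans: "x \<preceq> y \<Longrightarrow> y \<preceq> z \<Longrightarrow> x \<preceq> z"
  using partial_order_induced[OF seq] unfolding partial_order_on_def preorder_on_def
  by (meson transD)

lemma below_carrier: "x \<preceq> y \<Longrightarrow> x \<in> P \<and> y \<in> P"
  by (auto simp: induced_order_def mem_P_iff)

lemma below_fst: "x \<preceq> y \<Longrightarrow> fst y \<le> fst x"
  by (auto simp: induced_order_def)

lemma below_same_level: "x \<preceq> y \<Longrightarrow> fst x = fst y \<Longrightarrow> x = y"
  by (cases x; cases y) (auto simp: below_iff R_id)

lemma strictly_below_fst: "strictly_below r x y \<Longrightarrow> fst y < fst x"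
  using below_fst below_same_level by (fastforce simp: strictly_below_def)

lemma ex_above_in_level:
  assumes "x \<in> P" "n \<le> fst x"
  shows "\<exists>y\<in>level n. x \<preceq> y"
proof (cases x)
  case (Pair m p)
  then have "co_surjective (G m) (G n) (R n m)" and p: "p \<in> vertices (G m)"
    using seq assms by (auto simp: sequence_in_def S_morphism_def mem_P_iff)
  then obtain q where "(q, p) \<in> R n m"
    by (auto simp: co_surjective_def rel_image_def)
  then show ?thesis
    using Pair assms R_subset[of n m] by (intro bexI[of _ "(n, q)"]) (auto simp: below_iff mem_level_iff)
qed

text \<open>The composition law read backwards: a pair in the composite relation factors through any
  intermediate graph, so comparisons can be interpolated at every level in between.\<close>

lemma ex_between:
  assumes "x \<preceq> z" "fst z \<le> n" "n \<le> fst x"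
  shows "\<exists>y\<in>level n. x \<preceq> y \<and> y \<preceq> z"
proof (cases x; cases z)
  fix k p m q
  assume x: "x = (k, p)" and z: "z = (m, q)"
  then have "(q, p) \<in> R m n O R n k"
    using assms R_comp[of m n k] by (auto simp: below_iff)
  then obtain s where "(q, s) \<in> R m n" "(s, p) \<in> R n k"
    by blast
  then show ?thesis
    using x z assms R_subset[of m n] by (intro bexI[of _ "(n, s)"]) (auto simp: below_iff mem_level_iff)
qed

lemma adjacent_refl: "x \<in> P \<Longrightarrow> adjacent x x"
  using wf by (cases x) (auto simp: adjacent_def wf_graph_def mem_P_iff refl_on_def)

lemma adjacent_carrier: "adjacent x y \<Longrightarrow> x \<in> P \<and> y \<in> P"
  using wf by (cases x; cases y) (force simp: adjacent_def wf_graph_def mem_P_iff)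

lemma adjacent_below:
  assumes "adjacent x y" "x \<preceq> x'" "y \<preceq> y'" "fst x' = fst y'"
  shows "adjacent x' y'"
proof -
  obtain n p q m p' q' where xy: "x = (n, p)" "y = (n, q)" "x' = (m, p')" "y' = (m, q')"
    using assms by (cases x; cases y; cases x'; cases y') (auto simp: adjacent_def)
  then have "edge_preserving (G n) (G m) (R m n)"
    using seq assms by (auto simp: sequence_in_def S_morphism_def below_iff)
  then show ?thesis
    using assms xy by (auto simp: edge_preserving_def adjacent_def below_iff)
qed

section \<open>Properties of the relations expressed through the order and the levels\<close>

lemma seq_has_surjective_iff: "seq_has surjective G R \<longleftrightarrow> surjective_levels"
proof
  assume L: "seq_has surjective G R"
  show surjective_levels
    unfolding surjective_levels_def
  proof (intro ballI allI impI)
    fix x n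
    assume x: "x \<in> P" and n: "fst x \<le> n"
    show "\<exists>y\<in>level n. y \<preceq> x"
    proof (cases "fst x = n")
      case True
      then show ?thesis
        using x below_refl levelI by blast
    next
      case False
      then obtain g where "(snd x, g) \<in> R (fst x) n"
        using L n x by (cases x) (fastforce simp: seq_has_def surjective_def rel_preimage_def mem_P_iff)
      then show ?thesis
        using n R_subset[of "fst x" n]
        by (cases x) (intro bexI[of _ "(n, g)"], auto simp: below_iff mem_level_iff)
    qed
  qed
next
  assume S: surjective_levels
  have "\<exists>g. (h, g) \<in> R m n" if "m < n" "h \<in> vertices (G m)" for m n h
  proof -
    have "(m, h) \<in> P" "fst (m, h) \<le> n"
      using that by (auto simp: mem_P_iff)
    then obtain y where "y \<in> level n" "y \<preceq> (m, h)"
      using S unfolding surjective_levels_def by blast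
    then show ?thesis
      by (auto simp: level_eq below_iff)
  qed
  then show "seq_has surjective G R"
    unfolding seq_has_def surjective_def rel_preimage_def by blast
qed

lemma seq_has_co_injective_iff: "seq_has co_injective G R \<longleftrightarrow> coinjective_levels"
proof
  assume L: "seq_has co_injective G R"
  show coinjective_levels
    unfolding coinjective_levels_def
  proof (intro ballI allI impI)
    fix x n
    assume x: "x \<in> P" and n: "fst x \<le> n"
    show "\<exists>y\<in>level n. y \<preceq> x \<and> (\<forall>z\<in>level (fst x). y \<preceq> z \<longrightarrow> z = x)"
    proof (cases "fst x = n")
      case True
      then show ?thesis
        using x below_refl levelI below_same_level levelD by metis
    next
      case False
      then have "co_injective (G n) (G (fst x)) (R (fst x) n)" "snd x \<in> vertices (G (fst x))"
        using L n x by (auto simp: seq_has_def induced_poset_def)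
      then obtain g where g: "g \<in> vertices (G n)" "rel_image (R (fst x) n) g = {snd x}"
        unfolding co_injective_def by blast
      then have "(z, g) \<in> R (fst x) n \<longleftrightarrow> z = snd x" for z
        by (auto simp: rel_image_def)
      then show ?thesis
        using n g(1)
        by (cases x) (intro bexI[of _ "(n, g)"], auto simp: below_iff level_eq)
    qed
  qed
next
  assume C: coinjective_levels
  have "\<exists>g\<in>vertices (G n). rel_image (R m n) g = {h}" if "m < n" and h: "h \<in> vertices (G m)" for m n h
  proof -
    have "(m, h) \<in> P" "fst (m, h) \<le> n"
      using that by (auto simp: mem_P_iff)
    then have "\<exists>y\<in>level n. y \<preceq> (m, h) \<and> (\<forall>z\<in>level m. y \<preceq> z \<longrightarrow> z = (m, h))"
      using C unfolding coinjective_levels_def by (metis fst_conv)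
    then obtain y where y: "y \<in> level n" "y \<preceq> (m, h)"
        "\<And>z. z \<in> level m \<Longrightarrow> y \<preceq> z \<Longrightarrow> z = (m, h)"
      by blast
    then obtain g where g: "y = (n, g)" "g \<in> vertices (G n)"
      by (auto simp: level_eq)
    have "(h', g) \<in> R m n \<longleftrightarrow> h' = h" for h'
      using y(2) y(3)[of "(m, h')"] g \<open>m < n\<close> R_subset[of m n] by (auto simp: below_iff mem_level_iff)
    then show ?thesis
      using g by (auto simp: rel_image_def)
  qed
  then show "seq_has co_injective G R"
    unfolding seq_has_def co_injective_def by blast
qed

lemma anti_injective_iff:
  assumes "m \<le> n"
  shows "anti_injective (G n) (G m) (R m n) \<longleftrightarrow>
    (\<forall>x\<in>level m. \<exists>y\<in>level n. \<exists>z\<in>level n. y \<noteq> z \<and> y \<preceq> x \<and> z \<preceq> x)"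
proof -
  have "card (rel_preimage (R m n) h) \<ge> 2 \<longleftrightarrow>
      (\<exists>y\<in>level n. \<exists>z\<in>level n. y \<noteq> z \<and> y \<preceq> (m, h) \<and> z \<preceq> (m, h))" for h
  proof -
    have sub: "rel_preimage (R m n) h \<subseteq> vertices (G n)"
      using R_subset[OF assms] by (auto simp: rel_preimage_def)
    \<comment> \<open>\<open>card\<close> is 0 on infinite sets, so two distinct elements yield
      \<open>card \<ge> 2\<close> only because the preimage is finite.\<close>
    then have "finite (rel_preimage (R m n) h)"
      using wf[of n] finite_subset by (auto simp: wf_graph_def)
    then have "card (rel_preimage (R m n) h) \<ge> 2 \<longleftrightarrow>
        (\<exists>p\<in>rel_preimage (R m n) h. \<exists>q\<in>rel_preimage (R m n) h. p \<noteq> q)"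
      using card_le_Suc0_iff_eq[of "rel_preimage (R m n) h"] by auto
    also have "\<dots> \<longleftrightarrow> (\<exists>y\<in>level n. \<exists>z\<in>level n. y \<noteq> z \<and> y \<preceq> (m, h) \<and> z \<preceq> (m, h))"
      using sub assms by (auto simp: level_eq below_iff rel_preimage_def)
    finally show ?thesis .
  qed
  then show ?thesis
    by (simp add: anti_injective_def level_eq)
qed

lemma star_refining_iff:
  assumes "m \<le> n"
  shows "star_refining (G n) (G m) (R m n) \<longleftrightarrow>
    (\<forall>x\<in>level n. \<exists>h\<in>level m. \<forall>y. adjacent y x \<longrightarrow> y \<preceq> h)"
proof -
  have "{g'. (g', g) \<in> edges (G n)} \<subseteq> rel_preimage (R m n) h \<longleftrightarrow>
      (\<forall>y. adjacent y (n, g) \<longrightarrow> y \<preceq> (m, h))" for g h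
    using assms by (auto simp: rel_preimage_def adjacent_def below_iff)
  then show ?thesis
    by (simp add: star_refining_def level_eq)
qed

section \<open>Atoms and predetermined posets\<close>

text \<open>Without atoms one can always descend strictly, and each strict descent raises the level
  number by at least one.\<close>

lemma ex_deeper_below:
  assumes "atomless P r" "x \<in> P"
  shows "\<exists>y. y \<preceq> x \<and> n \<le> fst y"
proof (induction n)
  case 0
  then show ?case
    using below_refl[OF assms(2)] by blast
next
  case (Suc n)
  then obtain y where y: "y \<preceq> x" "n \<le> fst y"
    by blast
  then obtain z where "strictly_below r z y"
    using assms(1) below_carrier unfolding atomless_def atom_def by blast
  then have "z \<preceq> y" "fst y < fst z"
    using strictly_below_fst by (auto simp: strictly_below_def)
  then show ?case
    using y below_trans by (metis Suc_leI le_less_trans)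
qed

text \<open>A lower bound one level deeper is strictly lower, so surjectivity excludes atoms.
  Conversely, descend to level \<open>n\<close> or beyond and return to level \<open>n\<close> by
  interpolation.\<close>

lemma surjective_levels_iff_atomless: "surjective_levels \<longleftrightarrow> atomless P r"
proof
  assume S: surjective_levels
  have "\<not> atom P r x" for x
  proof
    assume a: "atom P r x"
    then obtain y where "y \<in> level (Suc (fst x))" "y \<preceq> x"
      using S unfolding surjective_levels_def atom_def by (metis le_SucI order_refl)
    then show False
      using a by (auto simp: atom_def strictly_below_def level_def)
  qed
  then show "atomless P r"
    by (simp add: atomless_def)
next
  assume "atomless P r"
  then show surjective_levels
    unfolding surjective_levels_def using ex_deeper_below ex_between by meson
qed

lemma coinjective_imp_surjective_levels: "coinjective_levels \<Longrightarrow> surjective_levels"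
  unfolding coinjective_levels_def surjective_levels_def by blast

text \<open>The witness is a private lower bound \<open>q\<close> of \<open>p\<close> in the next
  level. Whatever is strictly above \<open>q\<close> has level at most that of \<open>p\<close>, so
  the comparison factors through the level of \<open>p\<close>, and there only through
  \<open>p\<close>.\<close>

lemma coinjective_imp_predetermined:
  assumes C: coinjective_levels
  shows "predetermined P r"
  unfolding predetermined_def
proof (intro ballI impI)
  fix p
  assume p: "p \<in> P"
  then obtain q where q: "q \<in> level (Suc (fst p))" "q \<preceq> p"
      "\<And>z. z \<in> level (fst p) \<Longrightarrow> q \<preceq> z \<Longrightarrow> z = p"
    using C unfolding coinjective_levels_def by (metis le_SucI order_refl)
  have "p \<preceq> s" if "strictly_below r q s" for s
  proof -
    have "q \<preceq> s" "fst s \<le> fst p"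
      using that strictly_below_fst[OF that] q levelD by (auto simp: strictly_below_def)
    then obtain z where "z \<in> level (fst p)" "q \<preceq> z" "z \<preceq> s"
      using ex_between[of q s "fst p"] q levelD by auto
    then show ?thesis
      using q by blast
  qed
  moreover have "strictly_below r q s" if "p \<preceq> s" for s
    using q that below_trans below_fst[OF that] levelD[OF q(1)] by (auto simp: strictly_below_def)
  ultimately show "\<exists>q\<in>P. strictly_below r q p \<and> {s \<in> P. strictly_below r q s} = {s \<in> P. p \<preceq> s}"
    using q(1) below_refl[OF p] levelD by (intro bexI[of _ q]) blast+
qed

text \<open>The element that predetermines \<open>x\<close> is forced to be a private lower bound
  exactly one level deeper; iterating this reaches every deeper level.\<close>

lemma predetermined_atomless_imp_coinjective:
  assumes "predetermined P r" "atomless P r"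
  shows coinjective_levels
proof -
  have step: "\<exists>y\<in>level (Suc (fst x)). y \<preceq> x \<and> (\<forall>z\<in>level (fst x). y \<preceq> z \<longrightarrow> z = x)"
    if x: "x \<in> P" for x
  proof -
    obtain y where y: "y \<in> P" "strictly_below r y x"
        and eq: "{s \<in> P. strictly_below r y s} = {s \<in> P. x \<preceq> s}"
      using assms x unfolding predetermined_def atomless_def by blast
    have eqD: "x \<preceq> s" if "strictly_below r y s" for s
      using that eq below_carrier unfolding strictly_below_def by blast
    \<comment> \<open>Were \<open>y\<close> deeper, an upper bound \<open>s\<close> of it in the
      level just after that of \<open>x\<close> would be strictly above \<open>y\<close>, hence
      above \<open>x\<close>, although its level number is larger.\<close>
    have "fst y = Suc (fst x)"
    proof (rule ccontr)
      assume "fst y \<noteq> Suc (fst x)"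
      then have less: "Suc (fst x) < fst y"
        using strictly_below_fst[OF y(2)] by simp
      then obtain s where s: "s \<in> level (Suc (fst x))" "y \<preceq> s"
        using ex_above_in_level[OF y(1), of "Suc (fst x)"] by auto
      then have "strictly_below r y s"
        using less levelD(1)[OF s(1)] by (auto simp: strictly_below_def)
      then show False
        using eqD[of s] below_fst[of x s] levelD(1)[OF s(1)] by simp
    qed
    moreover have "z = x" if "z \<in> level (fst x)" "y \<preceq> z" for z
    proof -
      have "strictly_below r y z"
        using that levelD[OF that(1)] strictly_below_fst[OF y(2)] by (auto simp: strictly_below_def)
      then show ?thesis
        using eqD below_same_level levelD[OF that(1)] by metis
    qed
    ultimately show ?thesis
      using y levelI by (metis strictly_below_def)
  qed
  \<comment> \<open>Private lower bounds compose: a comparison of \<open>y'\<close> with some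
    \<open>z\<close> in the level of \<open>x\<close> factors through level
    \<open>fst x + k\<close>, where \<open>y\<close> is the only upper bound of
    \<open>y'\<close>.\<close>
  have "\<exists>y\<in>level (fst x + k). y \<preceq> x \<and> (\<forall>z\<in>level (fst x). y \<preceq> z \<longrightarrow> z = x)" if x: "x \<in> P" for x k
  proof (induction k)
    case 0
    then show ?case
      using x below_refl levelI below_same_level levelD by (metis add_0_right)
  next
    case (Suc k)
    then obtain y where y: "y \<in> level (fst x + k)" "y \<preceq> x"
        "\<And>z. z \<in> level (fst x) \<Longrightarrow> y \<preceq> z \<Longrightarrow> z = x"
      by blast
    obtain y' where y': "y' \<in> level (Suc (fst x + k))" "y' \<preceq> y"
        "\<And>z. z \<in> level (fst x + k) \<Longrightarrow> y' \<preceq> z \<Longrightarrow> z = y"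
      using step[of y] y(1) levelD by metis
    have "z = x" if z: "z \<in> level (fst x)" "y' \<preceq> z" for z
    proof -
      obtain w where "w \<in> level (fst x + k)" "y' \<preceq> w" "w \<preceq> z"
        using ex_between[OF z(2), of "fst x + k"] levelD[OF y'(1)] levelD[OF z(1)] by auto
      then show ?thesis
        using y y' z by blast
    qed
    then show ?case
      using y y' below_trans by (metis add_Suc_right)
  qed
  then show ?thesis
    unfolding coinjective_levels_def using le_Suc_ex by metis
qed

lemma coinjective_levels_iff:
  "coinjective_levels \<longleftrightarrow> predetermined P r \<and> atomless P r"
  using coinjective_imp_predetermined predetermined_atomless_imp_coinjective
    coinjective_imp_surjective_levels surjective_levels_iff_atomless by blast

end

section \<open>Caps in co-injective sequences\<close>

locale coinjective_sequence = graph_sequence +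
  assumes coinjective: coinjective_levels
begin

abbreviation Sp :: "(nat \<times> 'a) set set" where
  "Sp \<equiv> spectrum P r"

abbreviation X :: "(nat \<times> 'a) set topology" where
  "X \<equiv> spectrum_topology P r"

definition basic :: "nat \<times> 'a \<Rightarrow> (nat \<times> 'a) set set" where
  "basic x = {S \<in> Sp. x \<in> S}"

lemma ex_below_in_level: "x \<in> P \<Longrightarrow> fst x \<le> n \<Longrightarrow> \<exists>y\<in>level n. y \<preceq> x"
  using coinjective unfolding coinjective_levels_def by blast

lemma ex_below_unique:
  "x \<in> P \<Longrightarrow> fst x \<le> n \<Longrightarrow> \<exists>y\<in>level n. y \<preceq> x \<and> (\<forall>z\<in>level (fst x). y \<preceq> z \<longrightarrow> z = x)"
  using coinjective unfolding coinjective_levels_def by blast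

text \<open>Deeper elements have an upper bound in the level, shallower ones a lower bound.\<close>

lemma band_level: "band P r (level n)"
  unfolding band_def comparable_def
  using finite_level levelD ex_above_in_level ex_below_in_level by (meson nle_le subsetI)

text \<open>A band is finite, so all sufficiently deep levels lie beyond it; conversely every level
  is itself a band. Quantifying over all \<open>n \<ge> N\<close> lets later proofs deepen the level
  freely.\<close>

lemma cap_iff: "cap P r C \<longleftrightarrow> C \<subseteq> P \<and> (\<exists>N. \<forall>n\<ge>N. \<forall>x\<in>level n. \<exists>c\<in>C. x \<preceq> c)"
proof
  assume "cap P r C"
  then obtain B where "C \<subseteq> P" and B: "band P r B" "refines r B C"
    by (auto simp: cap_def)
  have "finite (fst ` B)"
    using B by (simp add: band_def)
  then obtain N where N: "\<And>b. b \<in> B \<Longrightarrow> fst b < N"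
    by (auto simp: finite_nat_set_iff_bounded)
  have "\<exists>c\<in>C. x \<preceq> c" if n: "n \<ge> N" and x: "x \<in> level n" for n x
  proof -
    obtain b where b: "b \<in> B" "comparable r x b"
      using B(1) levelD(2)[OF x] unfolding band_def by blast
    \<comment> \<open>As \<open>x\<close> is strictly deeper than \<open>b\<close>, comparability
      can only mean that \<open>x\<close> is below \<open>b\<close>.\<close>
    have "fst b < fst x"
      using N[OF b(1)] n levelD(1)[OF x] by simp
    then have "x \<preceq> b"
      using b(2) below_fst[of b x] by (auto simp: comparable_def)
    then show ?thesis
      using b(1) B(2) below_trans unfolding refines_def by blast
  qed
  then show "C \<subseteq> P \<and> (\<exists>N. \<forall>n\<ge>N. \<forall>x\<in>level n. \<exists>c\<in>C. x \<preceq> c)"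
    using \<open>C \<subseteq> P\<close> by blast
next
  assume "C \<subseteq> P \<and> (\<exists>N. \<forall>n\<ge>N. \<forall>x\<in>level n. \<exists>c\<in>C. x \<preceq> c)"
  then show "cap P r C"
    unfolding cap_def refines_def using band_level by blast
qed

lemma cap_if_level_refines:
  assumes "C \<subseteq> P" "\<And>x. x \<in> level N \<Longrightarrow> \<exists>c\<in>C. x \<preceq> c"
  shows "cap P r C"
  using assms band_level unfolding cap_def refines_def by blast

lemma cap_level: "cap P r (level n)"
  using levelD below_refl by (intro cap_if_level_refines[of _ n]) blast+

section \<open>Anti-injective sequences, branching and cap-determined posets\<close>

text \<open>Distinct elements of one level are incomparable, and of two lower bounds of
  \<open>q\<close> in the level of \<open>p\<close> at least one differs from
  \<open>p\<close>.\<close>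

lemma anti_injective_imp_branching:
  assumes "seq_has anti_injective G R"
  shows "branching P r"
  unfolding branching_def
proof (intro ballI impI)
  fix p q
  assume p: "p \<in> P" and q: "q \<in> P" and pq: "strictly_below r p q"
  have less: "fst q < fst p"
    using strictly_below_fst[OF pq] .
  then have "\<exists>y\<in>level (fst p). \<exists>z\<in>level (fst p). y \<noteq> z \<and> y \<preceq> q \<and> z \<preceq> q"
    using assms anti_injective_iff[of "fst q" "fst p"] levelI[OF q] by (auto simp: seq_has_def)
  then obtain s where s: "s \<in> level (fst p)" "s \<noteq> p" "s \<preceq> q"
    by metis
  then show "\<exists>s\<in>P. strictly_below r s q \<and> \<not> comparable r s p"
    using less levelD[OF s(1)] below_same_level[of s p] below_same_level[of p s]
    by (intro bexI[of _ s]) (auto simp: strictly_below_def comparable_def)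
qed

text \<open>Take \<open>p\<close> below \<open>q\<close> in level \<open>n\<close> and a branch
  \<open>s\<close> incomparable with \<open>p\<close>. Moving from \<open>s\<close> up or down to
  level \<open>n\<close>, without leaving the elements below \<open>q\<close>, gives a second lower
  bound; it cannot be \<open>p\<close>, or \<open>s\<close> would be comparable with
  \<open>p\<close>.\<close>

lemma branching_imp_anti_injective:
  assumes "branching P r"
  shows "seq_has anti_injective G R"
proof -
  have "\<exists>y\<in>level n. \<exists>z\<in>level n. y \<noteq> z \<and> y \<preceq> q \<and> z \<preceq> q"
    if less: "m < n" and "q \<in> level m" for m n q
  proof -
    have q: "q \<in> P" "fst q = m"
      using levelD[OF \<open>q \<in> level m\<close>] by auto
    obtain p where p: "p \<in> level n" "p \<preceq> q"
      using ex_below_in_level[of q n] q less by (metis less_imp_le)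
    then have "strictly_below r p q"
      using q levelD[OF p(1)] less by (auto simp: strictly_below_def)
    then obtain s where s: "s \<in> P" "s \<preceq> q" "\<not> s \<preceq> p" "\<not> p \<preceq> s"
      using assms p levelD[OF p(1)] q
      unfolding branching_def comparable_def strictly_below_def by metis
    show ?thesis
    proof (cases "n \<le> fst s")
      case True
      then obtain z where "z \<in> level n" "s \<preceq> z" "z \<preceq> q"
        using ex_between[OF s(2)] q less by (metis less_imp_le)
      moreover from this have "p \<noteq> z"
        using s by blast
      ultimately show ?thesis
        using p by blast
    next
      case False
      then obtain z where "z \<in> level n" "z \<preceq> s"
        using ex_below_in_level[OF s(1), of n] by (metis nle_le)
      moreover from this have "p \<noteq> z" "z \<preceq> q"
        using s below_trans by blast+
      ultimately show ?thesis
        using p by blast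
    qed
  qed
  then show ?thesis
    by (auto simp: seq_has_def anti_injective_iff)
qed

text \<open>If branching fails at \<open>p\<close> below \<open>q\<close>, then in deep levels
  everything below \<open>q\<close> is already below \<open>p\<close>. So \<open>p\<close> can
  replace \<open>q\<close> in every cap, and cap-determination would put \<open>q\<close> below
  \<open>p\<close>.\<close>

lemma cap_determined_imp_branching:
  assumes "cap_determined P r"
  shows "branching P r"
  unfolding branching_def
proof (intro ballI impI, rule ccontr)
  fix p q
  assume p: "p \<in> P" and q: "q \<in> P" and pq: "strictly_below r p q"
    and "\<not> (\<exists>s\<in>P. strictly_below r s q \<and> \<not> comparable r s p)"
  then have comp: "comparable r s p" if "strictly_below r s q" for s
    using that below_carrier unfolding strictly_below_def by blast
  have "cap P r ({p} \<union> F)" if F: "F \<subseteq> P" "cap P r ({q} \<union> F)" for F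
  proof -
    obtain N where N: "\<And>n x. n \<ge> N \<Longrightarrow> x \<in> level n \<Longrightarrow> \<exists>c\<in>{q} \<union> F. x \<preceq> c"
      using F(2) unfolding cap_iff by blast
    \<comment> \<open>This depth makes every \<open>x\<close> of level \<open>n\<close> below
      \<open>q\<close> strictly so, and lets \<open>p\<close> be below \<open>x\<close> only when
      they coincide.\<close>
    define n where "n = max N (fst p)"
    show ?thesis
    proof (rule cap_if_level_refines[where N = n])
      show "{p} \<union> F \<subseteq> P"
        using p F by blast
      fix x
      assume x: "x \<in> level n"
      then obtain c where c: "c \<in> {q} \<union> F" "x \<preceq> c"
        using N[of n] unfolding n_def by (metis max.cobounded1)
      have "x \<preceq> p" if "x \<preceq> q"
      proof -
        have fx: "fst x = n" "x \<in> P"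
          using levelD[OF x] by auto
        have "fst q < fst x"
          using strictly_below_fst[OF pq] fx by (simp add: n_def)
        then have "comparable r x p"
          using comp[of x] that unfolding strictly_below_def by blast
        moreover have "x = p" if "p \<preceq> x"
          using below_fst[OF that] below_same_level[OF that] fx by (simp add: n_def)
        ultimately show ?thesis
          using below_refl[OF p] by (auto simp: comparable_def)
      qed
      then show "\<exists>c\<in>{p} \<union> F. x \<preceq> c"
        using c by blast
    qed
  qed
  then have "q \<preceq> p"
    using assms p q unfolding cap_determined_def by blast
  then show False
    using below_fst strictly_below_fst[OF pq] by fastforce
qed

text \<open>If \<open>p\<close> is not below \<open>q\<close>, some \<open>x\<close> below
  \<open>p\<close> is not below \<open>q\<close> either, and a suitable \<open>F\<close> completes
  \<open>p\<close> to a cap while \<open>q\<close> together with \<open>F\<close> misses the private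
  lower bounds of \<open>x\<close>.\<close>

lemma anti_injective_imp_cap_determined:
  assumes "seq_has anti_injective G R"
  shows "cap_determined P r"
  unfolding cap_determined_def
proof (intro ballI impI, rule ccontr)
  fix p q
  assume p: "p \<in> P" and q: "q \<in> P" and pq: "\<not> p \<preceq> q"
    and caps: "\<forall>F. F \<subseteq> P \<longrightarrow> cap P r ({p} \<union> F) \<longrightarrow> cap P r ({q} \<union> F)"
  obtain x where x: "x \<preceq> p" "\<not> x \<preceq> q" "fst q \<le> fst x"
  proof (cases "fst q \<le> fst p")
    case True
    then show ?thesis
      using that below_refl[OF p] pq by blast
  next
    case False
    \<comment> \<open>Here \<open>q\<close> is deeper than \<open>p\<close>; of two lower bounds of
      \<open>p\<close> in the level of \<open>q\<close>, at least one is not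
      \<open>q\<close>.\<close>
    then have "\<exists>y\<in>level (fst q). \<exists>z\<in>level (fst q). y \<noteq> z \<and> y \<preceq> p \<and> z \<preceq> p"
      using assms anti_injective_iff[of "fst p" "fst q"] levelI[OF p] by (auto simp: seq_has_def)
    then obtain x where x: "x \<in> level (fst q)" "x \<noteq> q" "x \<preceq> p"
      by metis
    then have "\<not> x \<preceq> q" "fst q \<le> fst x"
      using below_same_level[of x q] levelD(1)[OF x(1)] by auto
    with x that show ?thesis
      by blast
  qed
  have xP: "x \<in> P"
    using below_carrier[OF x(1)] by blast
  define F where "F = {y \<in> level (fst x). \<not> y \<preceq> p}"
  have "cap P r ({p} \<union> F)"
  proof (rule cap_if_level_refines)
    show "{p} \<union> F \<subseteq> P"
      using p levelD by (auto simp: F_def)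
    show "\<exists>c\<in>{p} \<union> F. y \<preceq> c" if "y \<in> level (fst x)" for y
      using that below_refl[OF levelD(2)[OF that]] unfolding F_def by blast
  qed
  moreover have "F \<subseteq> P"
    using levelD(2) unfolding F_def by blast
  ultimately have "cap P r ({q} \<union> F)"
    using caps by blast
  then obtain n where n: "fst x \<le> n" "\<And>y. y \<in> level n \<Longrightarrow> \<exists>c\<in>{q} \<union> F. y \<preceq> c"
    unfolding cap_iff by (metis nle_le)
  \<comment> \<open>The only upper bound of \<open>y\<close> in the level of \<open>x\<close> is
    \<open>x\<close>, which is not in \<open>F\<close>; and \<open>y\<close> below \<open>q\<close>
    would factor through \<open>x\<close>, which is not below \<open>q\<close>.\<close>
  obtain y where y: "y \<in> level n" "y \<preceq> x" "\<And>z. z \<in> level (fst x) \<Longrightarrow> y \<preceq> z \<Longrightarrow> z = x"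
    using ex_below_unique[OF xP n(1)] by blast
  obtain c where c: "c \<in> {q} \<union> F" "y \<preceq> c"
    using n(2)[OF y(1)] by blast
  show False
  proof (cases "c \<in> F")
    case True
    then show ?thesis
      using y(3)[of c] c x(1) by (auto simp: F_def)
  next
    case False
    then have "y \<preceq> q"
      using c by auto
    then obtain z where "z \<in> level (fst x)" "y \<preceq> z" "z \<preceq> q"
      using ex_between[of y q "fst x"] x(3) levelD(1)[OF y(1)] n(1) by auto
    then show ?thesis
      using y(3) x(2) by blast
  qed
qed

subsection \<open>The spectrum\<close>

text \<open>Minimality means that each member \<open>x\<close> of \<open>S\<close> has a cap meeting
  \<open>S\<close> in \<open>x\<close> alone; upward closure and the eventual bound come from this
  cap. The description replaces quantification over caps by levels.\<close>

lemma mem_spectrum_iff: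
  "S \<in> Sp \<longleftrightarrow> S \<subseteq> P \<and> (\<forall>x\<in>S. \<forall>y. x \<preceq> y \<longrightarrow> y \<in> S) \<and> (\<forall>n. S \<inter> level n \<noteq> {}) \<and>
     (\<forall>x\<in>S. \<exists>N. \<forall>n\<ge>N. \<forall>y\<in>S \<inter> level n. y \<preceq> x)"
  (is "_ \<longleftrightarrow> ?rhs")
proof
  assume S: "S \<in> Sp"
  then have sel: "S \<subseteq> P" "\<And>C. cap P r C \<Longrightarrow> S \<inter> C \<noteq> {}"
    by (auto simp: spectrum_def selector_def)
  have own_cap: "\<exists>C. cap P r C \<and> S \<inter> C = {x}" if "x \<in> S" for x
  proof -
    have "\<not> selector P r (S - {x})"
      using S that by (auto simp: spectrum_def)
    then obtain C where C: "cap P r C" "(S - {x}) \<inter> C = {}"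
      using sel(1) by (auto simp: selector_def)
    then have "S \<inter> C = {x}"
      using sel(2)[OF C(1)] by blast
    with C show ?thesis
      by blast
  qed
  have up: "y \<in> S" if x: "x \<in> S" and xy: "x \<preceq> y" for x y
  proof -
    obtain C where C: "cap P r C" "S \<inter> C = {x}"
      using own_cap[OF x] by blast
    then obtain N where N: "C \<subseteq> P" "\<And>z. z \<in> level N \<Longrightarrow> \<exists>c\<in>C. z \<preceq> c"
      unfolding cap_iff by blast
    \<comment> \<open>Enlarging \<open>x\<close> to \<open>y\<close> keeps a cap, and
      \<open>S\<close> can meet the new cap only in \<open>y\<close>.\<close>
    have "cap P r (insert y (C - {x}))"
    proof (rule cap_if_level_refines)
      show "insert y (C - {x}) \<subseteq> P"
        using N(1) below_carrier[OF xy] by blast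
      show "\<exists>c\<in>insert y (C - {x}). z \<preceq> c" if "z \<in> level N" for z
        using N(2)[OF that] below_trans xy by blast
    qed
    then show ?thesis
      using sel(2) C(2) by blast
  qed
  have "\<exists>N. \<forall>n\<ge>N. \<forall>y\<in>S \<inter> level n. y \<preceq> x" if x: "x \<in> S" for x
  proof -
    obtain C where C: "cap P r C" "S \<inter> C = {x}"
      using own_cap[OF x] by blast
    then obtain N where N: "\<And>n z. n \<ge> N \<Longrightarrow> z \<in> level n \<Longrightarrow> \<exists>c\<in>C. z \<preceq> c"
      unfolding cap_iff by blast
    have "y \<preceq> x" if n: "n \<ge> N" and y: "y \<in> S \<inter> level n" for n y
    proof -
      obtain c where c: "c \<in> C" "y \<preceq> c"
        using N n y by blast
      then have "c \<in> S"
        using up y by blast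
      then have "c = x"
        using c(1) C(2) by blast
      with c(2) show ?thesis
        by simp
    qed
    then show ?thesis
      by blast
  qed
  then show ?rhs
    using sel(1) sel(2)[OF cap_level] up by simp
next
  assume ?rhs
  then have S: "S \<subseteq> P" "\<And>x y. x \<in> S \<Longrightarrow> x \<preceq> y \<Longrightarrow> y \<in> S" "\<And>n. \<exists>x. x \<in> S \<and> x \<in> level n"
      "\<And>x. x \<in> S \<Longrightarrow> \<exists>N. \<forall>n\<ge>N. \<forall>y\<in>S \<inter> level n. y \<preceq> x"
    by blast+
  have "S \<inter> C \<noteq> {}" if C: "cap P r C" for C
  proof -
    obtain N where N: "\<And>z. z \<in> level N \<Longrightarrow> \<exists>c\<in>C. z \<preceq> c"
      using C unfolding cap_iff by blast
    obtain s where s: "s \<in> S" "s \<in> level N"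
      using S(3) by blast
    then obtain c where "c \<in> C" "s \<preceq> c"
      using N by blast
    then show ?thesis
      using S(2) s by blast
  qed
  then have "selector P r S"
    using S(1) by (simp add: selector_def)
  moreover have "\<not> selector P r T" if T: "T \<subset> S" for T
  proof -
    obtain x where x: "x \<in> S" "x \<notin> T"
      using T by blast
    then obtain N where N: "\<And>y. y \<in> S \<inter> level N \<Longrightarrow> y \<preceq> x"
      using S(4)[OF x(1)] by blast
    \<comment> \<open>A cap avoided by \<open>T\<close>: elements of level \<open>N\<close> outside
      \<open>S\<close> are in it, and those inside \<open>S\<close> lie below
      \<open>x\<close>.\<close>
    let ?C = "insert x (level N - S)"
    have "cap P r ?C"
    proof (rule cap_if_level_refines)
      show "?C \<subseteq> P"
        using x S(1) levelD(2) by blast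
      show "\<exists>c\<in>?C. y \<preceq> c" if "y \<in> level N" for y
        using N that below_refl[OF levelD(2)[OF that]] by blast
    qed
    moreover have "T \<inter> ?C = {}"
      using T x by blast
    ultimately show ?thesis
      by (auto simp: selector_def)
  qed
  ultimately show "S \<in> Sp"
    by (simp add: spectrum_def)
qed

lemma spectrum_subset: "S \<in> Sp \<Longrightarrow> S \<subseteq> P"
  and spectrum_up: "S \<in> Sp \<Longrightarrow> x \<in> S \<Longrightarrow> x \<preceq> y \<Longrightarrow> y \<in> S"
  and spectrum_meets_level: "S \<in> Sp \<Longrightarrow> \<exists>x\<in>level n. x \<in> S"
  and spectrum_eventually_below: "S \<in> Sp \<Longrightarrow> x \<in> S \<Longrightarrow> \<exists>N. \<forall>n\<ge>N. \<forall>y\<in>S \<inter> level n. y \<preceq> x"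
  unfolding mem_spectrum_iff by blast+

lemma spectrum_meets_cap: "S \<in> Sp \<Longrightarrow> cap P r C \<Longrightarrow> \<exists>c\<in>C. c \<in> S"
  by (auto simp: spectrum_def selector_def)

lemma spectrum_eventually_below_finite:
  assumes "S \<in> Sp" "finite F" "F \<subseteq> S"
  shows "\<exists>N. \<forall>n\<ge>N. \<forall>y\<in>S \<inter> level n. \<forall>x\<in>F. y \<preceq> x"
proof -
  have "\<forall>x\<in>F. eventually (\<lambda>n. \<forall>y\<in>S \<inter> level n. y \<preceq> x) sequentially"
    using assms spectrum_eventually_below by (auto simp: eventually_sequentially)
  then have "eventually (\<lambda>n. \<forall>x\<in>F. \<forall>y\<in>S \<inter> level n. y \<preceq> x) sequentially"
    using assms(2) by (simp add: eventually_ball_finite)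
  then show ?thesis
    by (auto simp: eventually_sequentially)
qed

text \<open>Any member of \<open>S\<close> at a sufficiently deep level works, because finitely many
  eventual bounds hold simultaneously.\<close>

lemma spectrum_directed:
  assumes "S \<in> Sp" "finite F" "F \<subseteq> S"
  shows "\<exists>y\<in>S. n \<le> fst y \<and> (\<forall>x\<in>F. y \<preceq> x)"
proof -
  obtain N where N: "\<And>k y. k \<ge> N \<Longrightarrow> y \<in> S \<inter> level k \<Longrightarrow> \<forall>x\<in>F. y \<preceq> x"
    using spectrum_eventually_below_finite[OF assms] by blast
  obtain y where y: "y \<in> level (max N n)" "y \<in> S"
    using spectrum_meets_level[OF assms(1)] by blast
  then show ?thesis
    using N[of "max N n" y] levelD(1)[OF y(1)] by (intro bexI[of _ y]) auto
qed

text \<open>Minimal selectors are not nested, so some \<open>x\<close> lies in \<open>S\<close> but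
  not in \<open>T\<close>. Deep members of \<open>S\<close> are below \<open>x\<close>, and
  \<open>T\<close>, being upward closed, contains none of them.\<close>

lemma spectrum_eventually_disjoint:
  assumes "S \<in> Sp" "T \<in> Sp" "S \<noteq> T"
  shows "\<exists>N. \<forall>n\<ge>N. S \<inter> T \<inter> level n = {}"
proof -
  have "\<not> S \<subset> T"
    using assms(1,2) unfolding spectrum_def by blast
  then obtain x where x: "x \<in> S" "x \<notin> T"
    using assms(3) by blast
  then obtain N where N: "\<And>n y. n \<ge> N \<Longrightarrow> y \<in> S \<inter> level n \<Longrightarrow> y \<preceq> x"
    using spectrum_eventually_below[OF assms(1) x(1)] by blast
  have "S \<inter> T \<inter> level n = {}" if "n \<ge> N" for n
    using N[OF that] spectrum_up[OF assms(2)] x(2) by blast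
  then show ?thesis
    by blast
qed

text \<open>
  A maximal downward closed set that contains no level has a minimal selector as its complement.
\<close>

lemma ex_spectrum_subset:
  assumes up: "\<And>x y. \<lbrakk>x \<in> Q; x \<preceq> y\<rbrakk> \<Longrightarrow> y \<in> Q"
    and meets: "\<And>n. Q \<inter> level n \<noteq> {}"
  shows "\<exists>S\<in>Sp. S \<subseteq> Q"
proof -
  define \<A> where "\<A> = {Y. P - Q \<subseteq> Y \<and> Y \<subseteq> P \<and> (\<forall>x\<in>Y. \<forall>y. y \<preceq> x \<longrightarrow> y \<in> Y) \<and> (\<forall>n. \<not> level n \<subseteq> Y)}"
  have "\<not> level n \<subseteq> P - Q" for n
    using meets[of n] by blast
  then have "P - Q \<in> \<A>"
    using up below_carrier by (simp add: \<A>_def) blast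
  moreover have "\<Union>\<C> \<in> \<A>" if ne: "\<C> \<noteq> {}" and chain: "subset.chain \<A> \<C>" for \<C>
  proof -
    have sub: "\<C> \<subseteq> \<A>"
      using chain by (simp add: subset_chain_def)
    \<comment> \<open>A level is finite, so a chain that covers it has a single member that already
      does.\<close>
    have "\<not> level n \<subseteq> \<Union>\<C>" for n
    proof
      assume "level n \<subseteq> \<Union>\<C>"
      then obtain Y where "Y \<in> \<C>" "level n \<subseteq> Y"
        using finite_subset_Union_chain[OF finite_level _ ne chain] by blast
      then show False
        using sub by (auto simp: \<A>_def)
    qed
    moreover have "P - Q \<subseteq> \<Union>\<C>"
    proof -
      obtain Y where "Y \<in> \<C>"
        using ne by blast
      then show ?thesis
        using sub unfolding \<A>_def by blast
    qed
    moreover have "\<Union>\<C> \<subseteq> P"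
      using sub by (auto simp: \<A>_def)
    moreover have "y \<in> \<Union>\<C>" if "x \<in> \<Union>\<C>" "y \<preceq> x" for x y
      using that sub unfolding \<A>_def by blast
    ultimately show ?thesis
      unfolding \<A>_def by blast
  qed
  ultimately obtain M where M: "M \<in> \<A>" and max: "\<And>Y. Y \<in> \<A> \<Longrightarrow> M \<subseteq> Y \<Longrightarrow> Y = M"
    using subset_Zorn_nonempty[of \<A>] by blast
  have M': "P - Q \<subseteq> M" "M \<subseteq> P" "\<And>x y. x \<in> M \<Longrightarrow> y \<preceq> x \<Longrightarrow> y \<in> M" "\<And>n. \<not> level n \<subseteq> M"
    using M unfolding \<A>_def by blast+
  have "\<exists>N. \<forall>n\<ge>N. \<forall>y\<in>(P - M) \<inter> level n. y \<preceq> x" if x: "x \<in> P - M" for x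
  proof (rule ccontr)
    assume contr: "\<nexists>N. \<forall>n\<ge>N. \<forall>y\<in>(P - M) \<inter> level n. y \<preceq> x"
    \<comment> \<open>An element \<open>y\<close> at depth at least \<open>n\<close>, outside
      \<open>M\<close> and not below \<open>x\<close>, passes both properties to its upper bounds in
      level \<open>n\<close>. So \<open>M\<close> could be enlarged by the elements below
      \<open>x\<close>, against maximality.\<close>
    have "\<not> level n \<subseteq> M \<union> {y. y \<preceq> x}" for n
    proof -
      obtain k y where y: "k \<ge> n" "y \<in> P - M" "y \<in> level k" "\<not> y \<preceq> x"
        using contr by blast
      then obtain z where "z \<in> level n" "y \<preceq> z"
        using ex_above_in_level[of y n] levelD(1)[OF y(3)] by auto
      moreover from this have "z \<notin> M" "\<not> z \<preceq> x"
        using y M'(3) below_trans by blast+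
      ultimately show ?thesis
        by blast
    qed
    moreover have "M \<union> {y. y \<preceq> x} \<subseteq> P"
      using M'(2) below_carrier by blast
    moreover have "z \<in> M \<union> {y. y \<preceq> x}" if "y \<in> M \<union> {y. y \<preceq> x}" "z \<preceq> y" for y z
      using that M'(3) below_trans by blast
    ultimately have "M \<union> {y. y \<preceq> x} \<in> \<A>"
      using M'(1) unfolding \<A>_def by blast
    then have "M \<union> {y. y \<preceq> x} = M"
      by (rule max) blast
    then show False
      using x below_refl by blast
  qed
  moreover have "(P - M) \<inter> level n \<noteq> {}" for n
    using M'(4)[of n] levelD(2) by blast
  moreover have "y \<in> P - M" if "x \<in> P - M" "x \<preceq> y" for x y
    using that M'(3) below_carrier by blast
  ultimately have "P - M \<in> Sp"
    unfolding mem_spectrum_iff by blast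
  then show ?thesis
    using M'(1) by blast
qed

lemma cap_if_spectrum_meets:
  assumes "A \<subseteq> P" and meets: "\<And>S. S \<in> Sp \<Longrightarrow> S \<inter> A \<noteq> {}"
  shows "cap P r A"
proof (rule ccontr)
  assume not_cap: "\<not> cap P r A"
  define Q where "Q = {x \<in> P. \<forall>c\<in>A. \<not> x \<preceq> c}"
  have "\<exists>S\<in>Sp. S \<subseteq> Q"
  proof (rule ex_spectrum_subset)
    show up: "y \<in> Q" if "x \<in> Q" "x \<preceq> y" for x y
      using that below_trans below_carrier unfolding Q_def by blast
    show "Q \<inter> level n \<noteq> {}" for n
      using not_cap cap_if_level_refines[OF assms(1)] levelD unfolding Q_def by blast
  qed
  then show False
    using meets below_refl assms(1) unfolding Q_def by blast
qed

text \<open>A level without \<open>x\<close> is no cap, as it misses the private lower bounds of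
  \<open>x\<close>. Some minimal selector therefore avoids it, yet must meet the whole
  level.\<close>

lemma ex_spectrum_through:
  assumes "x \<in> P"
  shows "\<exists>S\<in>Sp. S \<inter> level (fst x) = {x}"
proof -
  have "\<not> cap P r (level (fst x) - {x})"
  proof
    assume "cap P r (level (fst x) - {x})"
    then obtain n where n: "n \<ge> fst x" "\<And>y. y \<in> level n \<Longrightarrow> \<exists>c\<in>level (fst x) - {x}. y \<preceq> c"
      unfolding cap_iff by (metis nle_le)
    then show False
      using ex_below_unique[OF assms n(1)] by blast
  qed
  then obtain S where "S \<in> Sp" "S \<inter> (level (fst x) - {x}) = {}"
    using cap_if_spectrum_meets[of "level (fst x) - {x}"] levelD by blast
  then show ?thesis
    using spectrum_meets_level[of S "fst x"] by blast
qed

lemma basic_mono: "x \<preceq> y \<Longrightarrow> basic x \<subseteq> basic y"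
  using spectrum_up unfolding basic_def by blast

lemma basic_nonempty: "x \<in> P \<Longrightarrow> basic x \<noteq> {}"
  using ex_spectrum_through unfolding basic_def by blast

text \<open>A selector in both basic sets is directed and yields a lower bound; conversely, the
  basic set of a lower bound is non-empty and lies in both.\<close>

lemma basic_disjoint_iff: "basic x \<inter> basic y = {} \<longleftrightarrow> \<not> common_lower_bound P r x y"
proof -
  have "common_lower_bound P r x y" if S: "S \<in> basic x \<inter> basic y" for S
  proof -
    have "S \<in> Sp" "{x, y} \<subseteq> S"
      using S by (auto simp: basic_def)
    then obtain z where "z \<in> S" "z \<preceq> x" "z \<preceq> y"
      using spectrum_directed[of S "{x, y}" 0] by blast
    then show ?thesis
      using below_carrier unfolding common_lower_bound_def by blast
  qed
  moreover have "basic x \<inter> basic y \<noteq> {}" if "common_lower_bound P r x y"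
    using that basic_nonempty basic_mono unfolding common_lower_bound_def by blast
  ultimately show ?thesis
    by blast
qed

section \<open>The topology of the spectrum\<close>

text \<open>Directedness of selectors makes the generating sets a base, not merely a
  subbase.\<close>

lemma openin_spectrum_iff:
  "openin X U \<longleftrightarrow> U \<subseteq> Sp \<and> (\<forall>S\<in>U. \<exists>x\<in>S. basic x \<subseteq> U)"
proof
  assume "openin X U"
  then have "generate_topology_on (insert Sp (basic ` P)) U"
    unfolding spectrum_topology_def basic_def by (simp add: openin_topology_generated_by_iff)
  then show "U \<subseteq> Sp \<and> (\<forall>S\<in>U. \<exists>x\<in>S. basic x \<subseteq> U)"
  proof induction
    case Empty
    then show ?case by blast
  next
    case (Int U W)
    have "\<exists>x\<in>S. basic x \<subseteq> U \<inter> W" if S: "S \<in> U \<inter> W" for S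
    proof -
      have "S \<in> Sp"
        using Int.IH(1) S by blast
      obtain x where x: "x \<in> S" "basic x \<subseteq> U"
        using Int.IH(1) S by blast
      obtain y where y: "y \<in> S" "basic y \<subseteq> W"
        using Int.IH(2) S by blast
      obtain z where "z \<in> S" "z \<preceq> x" "z \<preceq> y"
        using spectrum_directed[OF \<open>S \<in> Sp\<close>, of "{x, y}" 0] x y by blast
      then show ?thesis
        using x y basic_mono by blast
    qed
    then show ?case
      using Int.IH by blast
  next
    case (UN K)
    then show ?case
      by (meson Sup_upper Union_iff subset_iff)
  next
    case (Basis U)
    then consider "U = Sp" | x where "U = basic x"
      by blast
    then show ?case
    proof cases
      case 1
      then show ?thesis
        using spectrum_meets_level unfolding basic_def by blast
    next
      case 2
      then show ?thesis
        unfolding basic_def by blast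
    qed
  qed
next
  assume U: "U \<subseteq> Sp \<and> (\<forall>S\<in>U. \<exists>x\<in>S. basic x \<subseteq> U)"
  have "openin X (basic x)" if "x \<in> P" for x
    using that unfolding spectrum_topology_def basic_def by (intro topology_generated_by_Basis) blast
  then have "openin X (\<Union>{basic x |x. x \<in> P \<and> basic x \<subseteq> U})"
    by (intro openin_Union) blast
  moreover have "\<Union>{basic x |x. x \<in> P \<and> basic x \<subseteq> U} = U"
  proof
    show "U \<subseteq> \<Union>{basic x |x. x \<in> P \<and> basic x \<subseteq> U}"
    proof
      fix S
      assume S: "S \<in> U"
      then obtain x where x: "x \<in> S" "basic x \<subseteq> U"
        using U by blast
      moreover have "S \<in> Sp"
        using S U by blast
      ultimately have "S \<in> basic x" "x \<in> P"
        using spectrum_subset by (auto simp: basic_def)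
      then show "S \<in> \<Union>{basic x |x. x \<in> P \<and> basic x \<subseteq> U}"
        using x by blast
    qed
  qed blast
  ultimately show "openin X U"
    by simp
qed

lemma topspace_spectrum: "topspace X = Sp"
proof
  show "topspace X \<subseteq> Sp"
    using openin_topspace[of X] by (simp only: openin_spectrum_iff)
  have "openin X Sp"
    unfolding spectrum_topology_def by (intro topology_generated_by_Basis) blast
  then show "Sp \<subseteq> topspace X"
    by (rule openin_subset)
qed

lemma openin_basic: "openin X (basic x)"
  unfolding openin_spectrum_iff basic_def by blast

section \<open>Isolated points and anti-injective subsequences\<close>

text \<open>The non-empty open set \<open>basic x\<close> has two points; in deep levels these
  selectors share no element and all their members lie below \<open>x\<close>.\<close>

lemma eventually_split:
  assumes perfect: "has_no_isolated_points X" and x: "x \<in> P"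
  shows "\<forall>\<^sub>F n in sequentially. \<exists>y\<in>level n. \<exists>z\<in>level n. y \<noteq> z \<and> y \<preceq> x \<and> z \<preceq> x"
proof -
  obtain S where S: "S \<in> basic x"
    using basic_nonempty[OF x] by blast
  then have "S \<in> Sp"
    by (simp add: basic_def)
  then have "basic x \<noteq> {S}"
    using perfect openin_basic[of x] unfolding has_no_isolated_points_def topspace_spectrum by metis
  then obtain T where T: "T \<in> basic x" "S \<noteq> T"
    using S by blast
  have mem: "T \<in> Sp" "x \<in> S" "x \<in> T"
    using S T by (auto simp: basic_def)
  obtain N where N: "\<And>n. n \<ge> N \<Longrightarrow> S \<inter> T \<inter> level n = {}"
    using spectrum_eventually_disjoint[OF \<open>S \<in> Sp\<close> mem(1) T(2)] by blast
  obtain N1 where N1: "\<And>n y. n \<ge> N1 \<Longrightarrow> y \<in> S \<inter> level n \<Longrightarrow> y \<preceq> x"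
    using spectrum_eventually_below[OF \<open>S \<in> Sp\<close> mem(2)] by blast
  obtain N2 where N2: "\<And>n y. n \<ge> N2 \<Longrightarrow> y \<in> T \<inter> level n \<Longrightarrow> y \<preceq> x"
    using spectrum_eventually_below[OF mem(1,3)] by blast
  have "\<exists>y\<in>level n. \<exists>z\<in>level n. y \<noteq> z \<and> y \<preceq> x \<and> z \<preceq> x" if "n \<ge> Max {N, N1, N2}" for n
  proof -
    have n: "n \<ge> N" "n \<ge> N1" "n \<ge> N2"
      using that by auto
    obtain y where y: "y \<in> level n" "y \<in> S"
      using spectrum_meets_level[OF \<open>S \<in> Sp\<close>] by blast
    obtain z where z: "z \<in> level n" "z \<in> T"
      using spectrum_meets_level[OF mem(1)] by blast
    have "y \<noteq> z"
      using N[OF n(1)] y z by blast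
    moreover have "y \<preceq> x" "z \<preceq> x"
      using N1[OF n(2)] N2[OF n(3)] y z by blast+
    ultimately show ?thesis
      using y z by blast
  qed
  then show ?thesis
    unfolding eventually_sequentially by blast
qed

lemma anti_injective_subsequence_iff:
  "has_subsequence anti_injective G R \<longleftrightarrow> has_no_isolated_points X"
proof
  assume "has_subsequence anti_injective G R"
  then obtain \<phi> :: "nat \<Rightarrow> nat" where \<phi>: "strict_mono \<phi>"
      and anti: "\<And>m n. m < n \<Longrightarrow> anti_injective (G (\<phi> n)) (G (\<phi> m)) (R (\<phi> m) (\<phi> n))"
    unfolding has_subsequence_def seq_has_def by blast
  have "\<not> openin X {S}" if S: "S \<in> Sp" for S
  proof
    assume "openin X {S}"
    then obtain x where x: "x \<in> S" "basic x \<subseteq> {S}"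
      unfolding openin_spectrum_iff by blast
    then obtain N where N: "\<And>n y. n \<ge> N \<Longrightarrow> y \<in> S \<inter> level n \<Longrightarrow> y \<preceq> x"
      using spectrum_eventually_below[OF S] by blast
    obtain y where y: "y \<in> level (\<phi> N)" "y \<in> S"
      using spectrum_meets_level[OF S] by blast
    then have "y \<preceq> x"
      using N[of "\<phi> N"] strict_mono_imp_increasing[OF \<phi>] by blast
    have "\<phi> N \<le> \<phi> (Suc N)"
      using \<phi> by (simp add: strict_mono_less_eq)
    then obtain a b where ab: "a \<in> level (\<phi> (Suc N))" "b \<in> level (\<phi> (Suc N))" "a \<noteq> b"
        "a \<preceq> y" "b \<preceq> y"
      using anti[of N "Suc N"] y(1) anti_injective_iff[of "\<phi> N" "\<phi> (Suc N)"] by blast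
    \<comment> \<open>A selector meeting this level only in \<open>c\<close> contains
      \<open>x\<close>, hence equals \<open>S\<close>. Applied to both \<open>a\<close> and
      \<open>b\<close>, this contradicts \<open>a \<noteq> b\<close>.\<close>
    have *: "S \<inter> level (\<phi> (Suc N)) = {c}" if c: "c \<in> level (\<phi> (Suc N))" "c \<preceq> y" for c
    proof -
      obtain T where T: "T \<in> Sp" "T \<inter> level (\<phi> (Suc N)) = {c}"
        using ex_spectrum_through[OF levelD(2)[OF c(1)]] levelD(1)[OF c(1)] by auto
      then have "T \<in> basic c"
        by (auto simp: basic_def)
      then have "T = S"
        using basic_mono[OF below_trans[OF c(2) \<open>y \<preceq> x\<close>]] x(2) by blast
      then show ?thesis
        using T(2) by simp
    qed
    show False
      using *[OF ab(1,4)] *[OF ab(2,5)] ab(3) by simp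
  qed
  then show "has_no_isolated_points X"
    unfolding has_no_isolated_points_def topspace_spectrum by blast
next
  assume perfect: "has_no_isolated_points X"
  show "has_subsequence anti_injective G R"
  proof (rule has_subsequence_if_eventually)
    fix m
    \<comment> \<open>Each \<open>x\<close> has its own threshold; finiteness of the level makes it
      uniform.\<close>
    have "\<forall>x\<in>level m. \<forall>\<^sub>F n in sequentially.
        \<exists>y\<in>level n. \<exists>z\<in>level n. y \<noteq> z \<and> y \<preceq> x \<and> z \<preceq> x"
      using eventually_split[OF perfect] levelD(2) by blast
    then have "\<forall>\<^sub>F n in sequentially. \<forall>x\<in>level m.
        \<exists>y\<in>level n. \<exists>z\<in>level n. y \<noteq> z \<and> y \<preceq> x \<and> z \<preceq> x"
      by (rule eventually_ball_finite[OF finite_level])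
    then have "\<forall>\<^sub>F n in sequentially. anti_injective (G n) (G m) (R m n)"
      using eventually_ge_at_top[of m] by eventually_elim (simp add: anti_injective_iff)
    then show "\<exists>N. \<forall>n\<ge>N. anti_injective (G n) (G m) (R m n)"
      by (simp add: eventually_sequentially)
  qed
qed

section \<open>Star-refinement, regularity and Hausdorff separation\<close>

text \<open>The common lower bound carries a loop, and the relations preserve edges.\<close>

lemma adjacent_if_common_lower_bound:
  assumes "common_lower_bound P r x y" "fst x = fst y"
  shows "adjacent x y"
  using assms adjacent_below adjacent_refl unfolding common_lower_bound_def by blast

text \<open>The star of \<open>s\<close> in \<open>S\<close> lies below one \<open>h\<close>, which
  belongs to \<open>S\<close> and, deep enough, not to \<open>T\<close>. So no \<open>t\<close> in
  \<open>T\<close> at that level is adjacent to \<open>s\<close>, and the basic sets of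
  \<open>s\<close> and \<open>t\<close> are disjoint.\<close>

lemma star_refining_subsequence_imp_Hausdorff:
  assumes "has_subsequence star_refining G R"
  shows "Hausdorff_space X"
proof -
  obtain \<phi> :: "nat \<Rightarrow> nat" where \<phi>: "strict_mono \<phi>"
      and star: "\<And>m n. m < n \<Longrightarrow> star_refining (G (\<phi> n)) (G (\<phi> m)) (R (\<phi> m) (\<phi> n))"
    using assms unfolding has_subsequence_def seq_has_def by blast
  have "\<exists>U V. openin X U \<and> openin X V \<and> S \<in> U \<and> T \<in> V \<and> disjnt U V"
    if S: "S \<in> Sp" and T: "T \<in> Sp" and "S \<noteq> T" for S T
  proof -
    obtain N where N: "\<And>n. n \<ge> N \<Longrightarrow> S \<inter> T \<inter> level n = {}"
      using spectrum_eventually_disjoint[OF S T \<open>S \<noteq> T\<close>] by blast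
    define n where "n = \<phi> (Suc N)"
    have "\<phi> N \<le> n"
      using \<phi> by (simp add: n_def strict_mono_less_eq)
    have star': "\<exists>h\<in>level (\<phi> N). \<forall>y. adjacent y x \<longrightarrow> y \<preceq> h" if "x \<in> level n" for x
      using star[of N "Suc N"] star_refining_iff[OF \<open>\<phi> N \<le> n\<close>] that by (simp add: n_def)
    obtain s where s: "s \<in> level n" "s \<in> S"
      using spectrum_meets_level[OF S] by blast
    obtain t where t: "t \<in> level n" "t \<in> T"
      using spectrum_meets_level[OF T] by blast
    obtain h where h: "h \<in> level (\<phi> N)" "\<And>y. adjacent y s \<Longrightarrow> y \<preceq> h"
      using star'[OF s(1)] by blast
    have "h \<in> S"
      using h(2)[OF adjacent_refl] spectrum_up[OF S s(2)] levelD(2)[OF s(1)] by blast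
    then have "h \<notin> T"
      using N[of "\<phi> N"] h(1) strict_mono_imp_increasing[OF \<phi>] by blast
    then have "\<not> adjacent t s"
      using h(2) spectrum_up[OF T t(2)] by blast
    then have "\<not> common_lower_bound P r t s"
      using adjacent_if_common_lower_bound[of t s] levelD(1)[OF s(1)] levelD(1)[OF t(1)] by metis
    then have "disjnt (basic s) (basic t)"
      using basic_disjoint_iff[of t s] by (simp add: disjnt_def Int_commute)
    moreover have "S \<in> basic s" "T \<in> basic t"
      using S T s t by (auto simp: basic_def)
    ultimately show ?thesis
      using openin_basic by blast
  qed
  then show ?thesis
    unfolding Hausdorff_space_def topspace_spectrum by blast
qed

text \<open>Every selector missing \<open>h\<close> is separated from \<open>S\<close> by basic
  sets. The cap property turns this into finitely many conditions, one per element of a level, which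
  a single member of \<open>S\<close> satisfies at once.\<close>

lemma ex_star_below:
  assumes H: "Hausdorff_space X" and S: "S \<in> Sp" and h: "h \<in> S"
  shows "\<exists>p\<in>S. star_below P r p h"
proof -
  let ?A = "insert h {q \<in> P. \<exists>p\<in>S. basic p \<inter> basic q = {}}"
  have "cap P r ?A"
  proof (rule cap_if_spectrum_meets)
    show "?A \<subseteq> P"
      using spectrum_subset[OF S] h by blast
    fix T
    assume T: "T \<in> Sp"
    show "T \<inter> ?A \<noteq> {}"
    proof (cases "h \<in> T")
      case True
      then show ?thesis
        by blast
    next
      case False
      then have "S \<noteq> T"
        using h by blast
      then obtain U V where UV: "openin X U" "openin X V" "S \<in> U" "T \<in> V" "disjnt U V"
        using H S T unfolding Hausdorff_space_def topspace_spectrum by metis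
      obtain p where p: "p \<in> S" "basic p \<subseteq> U"
        using UV(1,3) unfolding openin_spectrum_iff by blast
      obtain q where q: "q \<in> T" "basic q \<subseteq> V"
        using UV(2,4) unfolding openin_spectrum_iff by blast
      have "q \<in> P"
        using q(1) spectrum_subset[OF T] by blast
      moreover have "basic p \<inter> basic q = {}"
        using p q UV(5) unfolding disjnt_def by blast
      ultimately show ?thesis
        using p(1) q(1) by blast
    qed
  qed
  then obtain N where N: "\<And>y. y \<in> level N \<Longrightarrow> \<exists>c\<in>?A. y \<preceq> c"
    unfolding cap_iff by blast
  have "\<exists>p\<in>S. basic p \<inter> basic y = {}" if y: "y \<in> level N" "\<not> y \<preceq> h" for y
  proof -
    obtain q where q: "q \<in> ?A" "y \<preceq> q"
      using N[OF y(1)] by blast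
    then obtain p where "p \<in> S" "basic p \<inter> basic q = {}"
      using y(2) by blast
    then show ?thesis
      using basic_mono[OF q(2)] by blast
  qed
  \<comment> \<open>\<open>f y\<close> is a member of \<open>S\<close> separated from
    \<open>y\<close>; a common lower bound \<open>p\<close> in \<open>S\<close> of these finitely
    many values is separated from all such \<open>y\<close>, so level \<open>N\<close> witnesses
    \<open>star_below P r p h\<close>.\<close>
  then obtain f where f: "\<And>y. \<lbrakk>y \<in> level N; \<not> y \<preceq> h\<rbrakk> \<Longrightarrow> f y \<in> S \<and> basic (f y) \<inter> basic y = {}"
    by metis
  have "finite (f ` {y \<in> level N. \<not> y \<preceq> h})" "f ` {y \<in> level N. \<not> y \<preceq> h} \<subseteq> S"
    using finite_level f by auto
  then obtain p where p: "p \<in> S" "\<forall>x\<in>f ` {y \<in> level N. \<not> y \<preceq> h}. p \<preceq> x"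
    using spectrum_directed[OF S] by blast
  have "c \<preceq> h" if c: "c \<in> level N" "common_lower_bound P r c p" for c
  proof (rule ccontr)
    assume nc: "\<not> c \<preceq> h"
    then have "p \<preceq> f c"
      using c(1) p(2) by blast
    then have "basic c \<inter> basic p = {}"
      using f[OF c(1) nc] basic_mono[of p "f c"] by blast
    then show False
      using c(2) basic_disjoint_iff by blast
  qed
  then have "star_below P r p h"
    unfolding star_below_def using cap_level by blast
  then show ?thesis
    using p(1) by blast
qed

lemma Hausdorff_imp_regular_poset:
  assumes H: "Hausdorff_space X"
  shows "regular_poset P r"
  unfolding regular_poset_def
proof (intro allI impI)
  fix C
  assume C: "cap P r C"
  let ?D = "{p \<in> P. \<exists>c\<in>C. star_below P r p c}"
  have "cap P r ?D"
  proof (rule cap_if_spectrum_meets)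
    fix S
    assume S: "S \<in> Sp"
    obtain c where c: "c \<in> C" "c \<in> S"
      using spectrum_meets_cap[OF S C] by blast
    obtain p where "p \<in> S" "star_below P r p c"
      using ex_star_below[OF H S c(2)] by blast
    then show "S \<inter> ?D \<noteq> {}"
      using c(1) spectrum_subset[OF S] by blast
  qed blast
  then show "\<exists>D. cap P r D \<and> (\<forall>d\<in>D. \<exists>c\<in>C. star_below P r d c)"
    by blast
qed

text \<open>Deep levels refine the witnessing cap, and a common lower bound persists when
  \<open>y\<close> and \<open>x\<close> are replaced by elements above them.\<close>

lemma star_below_eventually:
  assumes "star_below P r d c" "x \<preceq> d"
  shows "\<forall>\<^sub>F n in sequentially. \<forall>y\<in>level n. common_lower_bound P r y x \<longrightarrow> y \<preceq> c"
proof -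
  obtain C where C: "cap P r C" "\<And>b. b \<in> C \<Longrightarrow> common_lower_bound P r b d \<Longrightarrow> b \<preceq> c"
    using assms(1) unfolding star_below_def by blast
  then obtain N where N: "\<And>n y. n \<ge> N \<Longrightarrow> y \<in> level n \<Longrightarrow> \<exists>b\<in>C. y \<preceq> b"
    unfolding cap_iff by blast
  have "y \<preceq> c" if n: "n \<ge> N" and y: "y \<in> level n" and lb: "common_lower_bound P r y x" for n y
  proof -
    obtain b where b: "b \<in> C" "y \<preceq> b"
      using N[OF n y] by blast
    then have "common_lower_bound P r b d"
      using lb assms(2) below_trans unfolding common_lower_bound_def by meson
    then show ?thesis
      using C(2) b below_trans by meson
  qed
  then show ?thesis
    unfolding eventually_sequentially by blast
qed

text \<open>Regularity is applied to the cap \<open>level m\<close>, and a level \<open>k\<close>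
  refines the cap so obtained. For \<open>z\<close> below \<open>x\<close> in level
  \<open>k\<close>, faithfulness gives each neighbour of \<open>z\<close> a common lower bound with
  \<open>z\<close>, hence with \<open>x\<close>; so the star of \<open>z\<close> lies below
  \<open>c x\<close> once its level is deep.\<close>

lemma regular_poset_imp_star_refining_subsequence:
  assumes faithful: "edge_faithful G R" and regular: "regular_poset P r"
  shows "has_subsequence star_refining G R"
proof (rule has_subsequence_if_eventually)
  fix m
  have lb: "common_lower_bound P r x y" if "adjacent x y" for x y
    using that faithful adjacent_carrier[OF that] unfolding edge_faithful_def adjacent_def
    by (cases x; cases y) (auto simp: mem_P_iff)
  obtain D where D: "cap P r D" "\<And>d. d \<in> D \<Longrightarrow> \<exists>c\<in>level m. star_below P r d c"
    using regular[unfolded regular_poset_def, rule_format, OF cap_level[of m]] by blast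
  obtain k where k: "\<And>x. x \<in> level k \<Longrightarrow> \<exists>d\<in>D. x \<preceq> d"
    using D(1) unfolding cap_iff by blast
  have "\<exists>c. c \<in> level m \<and>
      (\<forall>\<^sub>F n in sequentially. \<forall>y\<in>level n. common_lower_bound P r y x \<longrightarrow> y \<preceq> c)"
    if "x \<in> level k" for x
    using k[OF that] D(2) star_below_eventually by meson
  then have "\<exists>c. \<forall>x\<in>level k. c x \<in> level m \<and>
      (\<forall>\<^sub>F n in sequentially. \<forall>y\<in>level n. common_lower_bound P r y x \<longrightarrow> y \<preceq> c x)"
    by (intro bchoice) blast
  then obtain c where c: "\<And>x. x \<in> level k \<Longrightarrow> c x \<in> level m"
      "\<And>x. x \<in> level k \<Longrightarrow>
        \<forall>\<^sub>F n in sequentially. \<forall>y\<in>level n. common_lower_bound P r y x \<longrightarrow> y \<preceq> c x"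
    by blast
  have "\<forall>\<^sub>F n in sequentially. \<forall>x\<in>level k. \<forall>y\<in>level n. common_lower_bound P r y x \<longrightarrow> y \<preceq> c x"
    using c(2) by (intro eventually_ball_finite finite_level) blast
  then have "\<forall>\<^sub>F n in sequentially. star_refining (G n) (G m) (R m n)"
    using eventually_ge_at_top[of m] eventually_ge_at_top[of k]
  proof eventually_elim
    case (elim n)
    have "\<exists>h\<in>level m. \<forall>y. adjacent y z \<longrightarrow> y \<preceq> h" if z: "z \<in> level n" for z
    proof -
      obtain x where x: "x \<in> level k" "z \<preceq> x"
        using ex_above_in_level[OF levelD(2)[OF z], of k] levelD(1)[OF z] elim(3) by blast
      have "y \<preceq> c x" if y: "adjacent y z" for y
      proof -
        have "y \<in> level n"
          using y adjacent_carrier[OF y] levelD(1)[OF z] levelI[of y] by (simp add: adjacent_def)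
        moreover have "common_lower_bound P r y x"
          using lb[OF y] x(2) below_trans unfolding common_lower_bound_def by meson
        ultimately show ?thesis
          using elim(1) x(1) by blast
      qed
      then show ?thesis
        using c(1)[OF x(1)] by blast
    qed
    then show ?case
      unfolding star_refining_iff[OF elim(2)] by blast
  qed
  then show "\<exists>N. \<forall>n\<ge>N. star_refining (G n) (G m) (R m n)"
    by (simp add: eventually_sequentially)
qed

section \<open>Compactness, a countable base and metrizability\<close>

text \<open>Elements whose basic sets fit into a member of the cover form a cap, so a finite level
  refines them; the basic sets of a level cover the spectrum.\<close>

lemma compact_space_spectrum: "compact_space X"
  unfolding compact_space_def compactin_def topspace_spectrum
proof (intro conjI allI impI)
  fix \<U>
  assume \<U>: "(\<forall>U\<in>\<U>. openin X U) \<and> Sp \<subseteq> \<Union>\<U>"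
  let ?A = "{x \<in> P. \<exists>U\<in>\<U>. basic x \<subseteq> U}"
  have "cap P r ?A"
  proof (rule cap_if_spectrum_meets)
    fix S
    assume S: "S \<in> Sp"
    then obtain U where U: "U \<in> \<U>" "S \<in> U"
      using \<U> by blast
    then obtain x where "x \<in> S" "basic x \<subseteq> U"
      using \<U> openin_spectrum_iff[of U] by blast
    then show "S \<inter> ?A \<noteq> {}"
      using U(1) spectrum_subset[OF S] by blast
  qed blast
  then obtain N where N: "\<And>y. y \<in> level N \<Longrightarrow> \<exists>x\<in>?A. y \<preceq> x"
    unfolding cap_iff by blast
  have "\<exists>U\<in>\<U>. basic y \<subseteq> U" if "y \<in> level N" for y
    using N[OF that] basic_mono[of y] by blast
  then obtain f where f: "\<And>y. y \<in> level N \<Longrightarrow> f y \<in> \<U> \<and> basic y \<subseteq> f y"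
    by metis
  have "S \<in> \<Union>(f ` level N)" if S: "S \<in> Sp" for S
  proof -
    obtain y where y: "y \<in> level N" "y \<in> S"
      using spectrum_meets_level[OF S] by blast
    then have "S \<in> basic y"
      using S by (simp add: basic_def)
    then show ?thesis
      using f y(1) by blast
  qed
  then show "\<exists>\<F>. finite \<F> \<and> \<F> \<subseteq> \<U> \<and> Sp \<subseteq> \<Union>\<F>"
    using f finite_level by (intro exI[of _ "f ` level N"]) blast
qed blast

lemma second_countable_spectrum: "second_countable X"
  unfolding second_countable_def
proof (intro exI[of _ "basic ` P"] conjI allI impI ballI)
  have "P = (\<Union>n. level n)"
    by (auto simp: level_def)
  then show "countable (basic ` P)"
    using countable_finite[OF finite_level] by simp
  show "openin X W" if "W \<in> basic ` P" for W
    using that openin_basic by blast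
  show "\<exists>W\<in>basic ` P. S \<in> W \<and> W \<subseteq> U" if U: "openin X U \<and> S \<in> U" for U S
  proof -
    obtain x where x: "x \<in> S" "basic x \<subseteq> U" and S: "S \<in> Sp"
      using U unfolding openin_spectrum_iff by blast
    moreover have "x \<in> P" "S \<in> basic x"
      using S x(1) spectrum_subset[OF S] by (auto simp: basic_def)
    ultimately show ?thesis
      by blast
  qed
qed

lemma Hausdorff_iff_metrizable: "Hausdorff_space X \<longleftrightarrow> metrizable_space X"
  using compact_Hausdorff_second_countable_imp_metrizable_space[OF compact_space_spectrum]
    second_countable_spectrum metrizable_imp_Hausdorff_space by blast

end

lemma (in graph_sequence) coinjective_sequence_if_B_morphism:
  assumes "sequence_in B_morphism G R"
  shows "coinjective_sequence G R"
proof
  have "seq_has co_injective G R"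
    using assms by (simp add: sequence_in_def seq_has_def B_morphism_def co_bijective_def)
  then show coinjective_levels
    by (simp add: seq_has_co_injective_iff)
qed

theorem proposition4p18:
  fixes G :: "nat \<Rightarrow> 'a graph"
    and R :: "nat \<Rightarrow> nat \<Rightarrow> 'a rel"
    and P :: "(nat \<times> 'a) set"
    and r :: "(nat \<times> 'a) rel"
  assumes "sequence_in S_morphism G R"
    and "P = induced_poset G"
    and "r = induced_order G R"
  shows
    "(seq_has surjective G R \<longleftrightarrow> atomless P r) \<and>
     (seq_has co_injective G R \<longleftrightarrow> predetermined P r \<and> atomless P r) \<and>
     (sequence_in B_morphism G R \<longrightarrow>
        (has_subsequence anti_injective G R \<longleftrightarrow> has_no_isolated_points (spectrum_topology P r)) \<and>
        ((seq_has anti_injective G R \<longleftrightarrow> branching P r) \<and>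
         (branching P r \<longleftrightarrow> cap_determined P r))) \<and>
     (sequence_in B_morphism G R \<and> edge_faithful G R \<longrightarrow>
        (has_subsequence star_refining G R \<longleftrightarrow> regular_poset P r) \<and>
        (regular_poset P r \<longleftrightarrow> Hausdorff_space (spectrum_topology P r)) \<and>
        (Hausdorff_space (spectrum_topology P r) \<longleftrightarrow> metrizable_space (spectrum_topology P r)))"
proof -
  interpret graph_sequence G R
    by unfold_locales (rule assms(1))
  have B: "coinjective_sequence G R" if "sequence_in B_morphism G R"
    using that by (rule coinjective_sequence_if_B_morphism)
  show ?thesis
    unfolding assms(2,3)
  proof (intro conjI impI; (elim conjE)?)
    show "seq_has surjective G R \<longleftrightarrow> atomless (induced_poset G) (induced_order G R)"
      by (simp add: seq_has_surjective_iff surjective_levels_iff_atomless)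
    show "seq_has co_injective G R \<longleftrightarrow>
        predetermined (induced_poset G) (induced_order G R) \<and> atomless (induced_poset G) (induced_order G R)"
      by (simp add: seq_has_co_injective_iff coinjective_levels_iff)
  next
    assume "sequence_in B_morphism G R"
    then interpret coinjective_sequence G R
      by (rule B)
    show "has_subsequence anti_injective G R \<longleftrightarrow>
        has_no_isolated_points (spectrum_topology (induced_poset G) (induced_order G R))"
      by (rule anti_injective_subsequence_iff)
    show "seq_has anti_injective G R \<longleftrightarrow> branching (induced_poset G) (induced_order G R)"
      using anti_injective_imp_branching branching_imp_anti_injective by blast
    \<comment> \<open>The cycle runs from branching to anti-injective to cap-determined and back to
      branching.\<close>
    show "branching (induced_poset G) (induced_order G R) \<longleftrightarrow>
        cap_determined (induced_poset G) (induced_order G R)"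
      using branching_imp_anti_injective anti_injective_imp_cap_determined
        cap_determined_imp_branching by blast
  next
    assume "sequence_in B_morphism G R" and faithful: "edge_faithful G R"
    then interpret coinjective_sequence G R
      by (blast intro: B)
    \<comment> \<open>This and the next equivalence come from one cycle: a star-refining subsequence
      gives a Hausdorff spectrum, that gives regularity, and edge-faithfulness leads back.\<close>
    show "has_subsequence star_refining G R \<longleftrightarrow>
        regular_poset (induced_poset G) (induced_order G R)"
      using star_refining_subsequence_imp_Hausdorff Hausdorff_imp_regular_poset
        regular_poset_imp_star_refining_subsequence[OF faithful] by blast
    show "regular_poset (induced_poset G) (induced_order G R) \<longleftrightarrow>
        Hausdorff_space (spectrum_topology (induced_poset G) (induced_order G R))"
      using star_refining_subsequence_imp_Hausdorff Hausdorff_imp_regular_poset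
        regular_poset_imp_star_refining_subsequence[OF faithful] by blast
    show "Hausdorff_space (spectrum_topology (induced_poset G) (induced_order G R)) \<longleftrightarrow>
        metrizable_space (spectrum_topology (induced_poset G) (induced_order G R))"
      by (rule Hausdorff_iff_metrizable)
  qed
qed

end
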